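(* Fix $s\ge1$, $2\le\ell\le s$, $\varepsilon>0$. Put $\mathrm{SRF}:=\frac{\pi}{\Delta\Omega}$. Then the following hold. 1. For any $\rho\ge0$, $\tau\ge\ell-1$ and $M\ge\pi$, there exists $\alpha\ge M$ such that for all sufficiently small $\Delta$ it holds that $$\mathcal{E}\left(\mathcal{R}(\Delta,\rho,s,\ell,\tau),\Omega,\varepsilon\right)\le C_{s,\ell}\,\mathrm{SRF}^{2\ell-1}\,\varepsilon,\qquad \mathrm{SRF}=\alpha,$$ for some absolute constant $C_{s,\ell}$ depending only on $s$ and $\ell$. 2. There exist an absolute constant $\beta\gg1$ and $\rho',\tau'$, depending only on $s,\ell$, such that for any $\Delta<\frac{\pi}{2(2\ell-1)}$ it holds that $$\mathcal{E}\left(\mathcal{R}(\Delta,\rho',s,\ell,\tau'),\Omega,\varepsilon\right)\ge C_\ell\,\mathrm{SRF}^{2\ell-1}\,\varepsilon,\qquad \mathrm{SRF}>\beta,$$ for some absolute constant $C_\ell$ depending only on $\ell$.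
   Context: Here $s,\ell$ are integers and $\Delta,\Omega>0$. Wrap-around distance: for $t\in\mathbb{R}$, $\|t\|_{\mathbb{T}}:=|\operatorname{Arg}\exp(\imath t)|=|t \bmod (-\pi,\pi]|$, where $\operatorname{Arg}$ takes values in $(-\pi,\pi]$. Clustered configuration: let $\Delta>0$, $2\le\ell\le s$, $\ell-1\le\tau<\pi/\Delta$, $\rho\ge 0$. A vector $\boldsymbol{x}=(t_1,\dots,t_s)$ of $s$ distinct nodes in $(-\frac{\pi}{2},\frac{\pi}{2}]$ forms a $(\Delta,\rho,s,\ell,\tau)$-clustered configuration if for each $t_j$ there exist at most $\ell$ distinct nodes $\boldsymbol{x}^{(j)}=\{t_{j,k}\}_{k=1,\dots,r_j}\subset\boldsymbol{x}$, $1\le r_j\le \ell$, $t_{j,1}\equiv t_j$, such that: (1) for any $y\in\boldsymbol{x}^{(j)}\setminus\{t_j\}$, $\Delta\le\|y-t_j\|_{\mathbb{T}}\le\tau\Delta$; (2) for any $y\in\boldsymbol{x}\setminus\boldsymbol{x}^{(j)}$, $\|y-t_j\|_{\mathbb{T}}\ge\rho$. Grid: $\mathcal{T}_\Delta:=\{k\Delta:\ k=-\lfloor\frac{\pi}{2\Delta}\rfloor,\dots,\lfloor\frac{\pi}{2\Delta}\rfloor\}\subset[-\frac{\pi}{2},\frac{\pi}{2}]$. Class of measures: $\mathcal{R}(\Delta,\rho,s,\ell,\tau)$ is the set of point measures $\mu=\sum_{j=1}^s a_j\delta_{t_j}$ with $t_j\in\mathcal{T}_\Delta$, $a_j\in\mathbb{C}$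 ($\delta_t$ the Dirac measure at $t$), such that $(t_1,\dots,t_s)$ forms a $(\Delta,\rho,s,\ell,\tau)$-clustered configuration. Fourier transform: for $\mu=\sum_j a_j\delta_{t_j}$, $\widehat\mu(\omega)=\sum_j a_j\exp(\imath\omega t_j)$. Norms: $\|f\|_{2,\Omega}^2:=\frac{1}{2\Omega}\int_{-\Omega}^{\Omega}|f(\omega)|^2d\omega$ on $L_2([-\Omega,\Omega])$ (complex-valued functions), and for a finite discrete measure $\mu=\sum_j a_j\delta_{t_j}$ (distinct $t_j$), $\|\mu\|_2:=\left(\sum_j|a_j|^2\right)^{1/2}$. Minimax error: for $\mathcal{R}=\mathcal{R}(\Delta,\rho,s,\ell,\tau)$, $\Omega>0$, $\varepsilon>0$, $$\mathcal{E}(\mathcal{R},\Omega,\varepsilon):=\inf_{\widetilde\mu}\ \sup_{\mu\in\mathcal{R}}\ \sup_{e\in L_2([-\Omega,\Omega]),\ \|e\|_{2,\Omega}\le\varepsilon}\ \|\widetilde\mu(\Phi_{\mu,e})-\mu\|_2,$$ where the infimum is over all deterministic mappings $\widetilde\mu:L_2([-\Omega,\Omega])\to\mathcal{R}$, and $\Phi_{\mu,e}(\omega)=\widehat\mu(\omega)+e(\omega)$ for $\omega\in[-\Omega,\Omega]$.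
   Formalization: Part 1 is stated for ρ>0, or ρ=0 with s=ℓ (for ρ=0, s>ℓ every s-node grid set is clustered, so the error grows like SRF^(2s-1) and the bound fails), and only where the class R is nonempty (for large ρ it is empty and no mapping into R exists). *)

theory Defs
  imports "HOL-Analysis.Analysis" "HOL-Library.Poly_Mapping"
begin

definition wrap_norm :: "real \<Rightarrow> real" where
  "wrap_norm t = \<bar>Arg (exp (\<i> * complex_of_real t))\<bar>"

text \<open>The cluster attached to the node \<open>t j\<close> is the set \<open>Y\<close>. The standing restrictions
  \<open>\<Delta> > 0\<close>, \<open>2 \<le> l \<le> s\<close>, \<open>l - 1 \<le> \<tau> < pi / \<Delta>\<close>, \<open>\<rho> \<ge> 0\<close> on the parameters are
  not part of the predicate.\<close>

definition clustered_configuration ::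
    "real \<Rightarrow> real \<Rightarrow> nat \<Rightarrow> nat \<Rightarrow> real \<Rightarrow> (nat \<Rightarrow> real) \<Rightarrow> bool" where
  "clustered_configuration \<Delta> \<rho> s l \<tau> t \<longleftrightarrow>
     inj_on t {1..s} \<and> t ` {1..s} \<subseteq> {-(pi/2)<..pi/2} \<and>
     (\<forall>j\<in>{1..s}. \<exists>Y. Y \<subseteq> t ` {1..s} \<and> t j \<in> Y \<and> card Y \<le> l \<and>
        (\<forall>y\<in>Y - {t j}. \<Delta> \<le> wrap_norm (y - t j) \<and> wrap_norm (y - t j) \<le> \<tau> * \<Delta>) \<and>
        (\<forall>y\<in>t ` {1..s} - Y. \<rho> \<le> wrap_norm (y - t j)))"

definition grid :: "real \<Rightarrow> real set" where
  "grid \<Delta> = {of_int k * \<Delta> | k :: int. - \<lfloor>pi / (2 * \<Delta>)\<rfloor> \<le> k \<and> k \<le> \<lfloor>pi / (2 * \<Delta>)\<rfloor>}"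

text \<open>A finite discrete complex measure on the real line is the finitely supported map
  sending a point to its mass; \<open>Poly_Mapping.single t a\<close> is \<open>a\<close> times the Dirac measure
  at \<open>t\<close>.\<close>

type_synonym point_measure = "real \<Rightarrow>\<^sub>0 complex"

definition cluster_measures ::
    "real \<Rightarrow> real \<Rightarrow> nat \<Rightarrow> nat \<Rightarrow> real \<Rightarrow> point_measure set" where
  "cluster_measures \<Delta> \<rho> s l \<tau> =
     {\<Sum>j = 1..s. Poly_Mapping.single (t j) (a j) | t a.
        t ` {1..s} \<subseteq> grid \<Delta> \<and> clustered_configuration \<Delta> \<rho> s l \<tau> t}"

definition fourier :: "point_measure \<Rightarrow> real \<Rightarrow> complex" where
  "fourier \<mu> \<omega> =
     (\<Sum>t\<in>Poly_Mapping.keys \<mu>. Poly_Mapping.lookup \<mu> t * exp (\<i> * complex_of_real (\<omega> * t)))"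

definition measure_norm2 :: "point_measure \<Rightarrow> real" where
  "measure_norm2 \<mu> = sqrt (\<Sum>t\<in>Poly_Mapping.keys \<mu>. (cmod (Poly_Mapping.lookup \<mu> t))\<^sup>2)"

definition L2_band :: "real \<Rightarrow> (real \<Rightarrow> complex) set" where
  "L2_band \<Omega> = {f. f \<in> borel_measurable (lebesgue_on {-\<Omega>..\<Omega>}) \<and>
                   integrable (lebesgue_on {-\<Omega>..\<Omega>}) (\<lambda>\<omega>. (cmod (f \<omega>))\<^sup>2)}"

definition L2_band_norm :: "real \<Rightarrow> (real \<Rightarrow> complex) \<Rightarrow> real" where
  "L2_band_norm \<Omega> f =
     sqrt (1 / (2 * \<Omega>) * (\<integral>\<omega>. (cmod (f \<omega>))\<^sup>2 \<partial>lebesgue_on {-\<Omega>..\<Omega>}))"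

text \<open>Elements of \<open>L\<^sub>2\<close> are represented by functions, so a mapping defined on \<open>L\<^sub>2\<close>
  has to agree on representatives that are equal almost everywhere on the band.\<close>

definition reconstructions ::
    "point_measure set \<Rightarrow> real \<Rightarrow> ((real \<Rightarrow> complex) \<Rightarrow> point_measure) set" where
  "reconstructions R \<Omega> =
     {m. m ` L2_band \<Omega> \<subseteq> R \<and>
         (\<forall>f\<in>L2_band \<Omega>. \<forall>g\<in>L2_band \<Omega>.
            (AE \<omega> in lebesgue_on {-\<Omega>..\<Omega>}. f \<omega> = g \<omega>) \<longrightarrow> m f = m g)}"

text \<open>If \<open>R\<close> is empty then there are no reconstructions and the minimax error is \<open>\<infinity>\<close>.\<close>

definition minimax_error :: "point_measure set \<Rightarrow> real \<Rightarrow> real \<Rightarrow> ennreal" where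
  "minimax_error R \<Omega> \<epsilon> =
     (INF m\<in>reconstructions R \<Omega>. SUP \<mu>\<in>R. SUP e\<in>{e \<in> L2_band \<Omega>. L2_band_norm \<Omega> e \<le> \<epsilon>}.
        ennreal (measure_norm2 (m (\<lambda>\<omega>. fourier \<mu> \<omega> + e \<omega>) - \<mu>)))"

definition SRF :: "real \<Rightarrow> real \<Rightarrow> real" where
  "SRF \<Delta> \<Omega> = pi / (\<Delta> * \<Omega>)"

end

theory Submission
  imports Defs
begin

text \<open>Both bounds say how well the Fourier transform on the band separates two measures of the
  class. Two measures whose transforms are \<open>\<epsilon>\<close>-close force an error of half the norm of their
  difference (\<open>minimax_error_ge\<close>). Conversely, a bound for the norm of the difference of any two
  measures with \<open>2 \<epsilon>\<close>-close transforms is a bound for the minimax error (\<open>minimax_error_le\<close>).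

  Upper bound. Let \<open>F(\<omega>) = \<Sum>t. a t * exp (\<i> \<omega> t)\<close> be the transform of such a difference; it has
  at most \<open>2 s\<close> nodes. Passing from \<open>F(\<omega>)\<close> to \<open>F(\<omega>) - exp (- \<i> \<theta> u) F(\<omega> + \<theta>)\<close> removes the node \<open>u\<close> and
  multiplies the amplitude of every other node \<open>t\<close> by \<open>1 - exp (\<i> \<theta> (t - u))\<close>. Removing all nodes
  but one, with shifts of total length at most \<open>\<Omega>\<close> so that the band still contains the translates of
  its left half, isolates one amplitude. A node at distance more than a constant times \<open>1 / \<Omega>\<close> is
  removed with the shift \<open>\<theta> = pi / \<bar>t - u\<bar>\<close>, for which the multiplier has modulus 2, so it costs no power
  of \<open>SRF\<close>. A closer one is still at distance at least \<open>\<Delta>\<close> because of the grid, and the shift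
  \<open>\<Omega> / (2 s)\<close> gives a multiplier of size at least a constant times \<open>\<Delta> \<Omega>\<close>, that is \<open>1 / SRF\<close>. A ball
  of radius \<open>\<rho> / 2\<close> contains at most \<open>l\<close> nodes of each of the two measures, so once \<open>\<Omega> \<rho>\<close> is large there
  are at most \<open>2 l - 1\<close> close nodes, which is the exponent; for \<open>l = s\<close> this holds
  because there are only \<open>2 s\<close> nodes (\<open>amplitude_bound\<close>, \<open>cluster_measures_stable\<close>).

  Lower bound. Put the coefficients of \<open>(1 - z) ^ (2 l - 1)\<close> on the \<open>2 l\<close> consecutive grid points
  \<open>0, \<Delta>, \<dots>, (2 l - 1) \<Delta>\<close>. The transform is \<open>(1 - exp (\<i> \<omega> \<Delta>)) ^ (2 l - 1)\<close>, of size at most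
  \<open>(\<Delta> \<Omega>) ^ (2 l - 1)\<close> on the band, although the measure has norm at least 1. Its even and its odd part,
  the latter with reversed sign, are supported on one cluster of \<open>l\<close> nodes each. Nodes of mass zero
  complete them to measures of the class (\<open>alternate_cluster_measures\<close>).\<close>

section \<open>Point measures and their Fourier transforms\<close>

lemma fourier_superset:
  assumes "finite K" "Poly_Mapping.keys \<mu> \<subseteq> K"
  shows "fourier \<mu> \<omega> =
    (\<Sum>t\<in>K. Poly_Mapping.lookup \<mu> t * exp (\<i> * complex_of_real (\<omega> * t)))"
  unfolding fourier_def
  by (rule sum.mono_neutral_left) (use assms in \<open>auto simp: in_keys_iff\<close>)

lemma fourier_diff: "fourier (\<mu> - \<nu>) \<omega> = fourier \<mu> \<omega> - fourier \<nu> \<omega>"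
proof -
  define K where "K = Poly_Mapping.keys \<mu> \<union> Poly_Mapping.keys \<nu>"
  have K: "finite K" "Poly_Mapping.keys \<mu> \<subseteq> K" "Poly_Mapping.keys \<nu> \<subseteq> K"
    "Poly_Mapping.keys (\<mu> - \<nu>) \<subseteq> K"
    unfolding K_def using keys_diff[of \<mu> \<nu>] by auto
  show ?thesis
    by (simp add: fourier_superset[OF K(1,2)] fourier_superset[OF K(1,3)]
        fourier_superset[OF K(1,4)] lookup_minus sum_subtractf left_diff_distrib)
qed

lemma fourier_zero [simp]: "fourier 0 \<omega> = 0"
  by (simp add: fourier_def)

lemma fourier_add: "fourier (\<mu> + \<nu>) \<omega> = fourier \<mu> \<omega> + fourier \<nu> \<omega>"
  using fourier_diff[of \<mu> "0 - \<nu>" \<omega>] fourier_diff[of 0 \<nu> \<omega>] by simp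

lemma fourier_sum: "fourier (\<Sum>i\<in>I. \<mu> i) \<omega> = (\<Sum>i\<in>I. fourier (\<mu> i) \<omega>)"
  by (induction I rule: infinite_finite_induct) (auto simp: fourier_add)

lemma fourier_single:
  "fourier (Poly_Mapping.single t a) \<omega> = a * exp (\<i> * complex_of_real (\<omega> * t))"
  by (subst fourier_superset[of "{t}"]) auto

lemma continuous_on_fourier [continuous_intros]: "continuous_on A (fourier \<mu>)"
  unfolding fourier_def [abs_def] by (intro continuous_intros)

lemma measure_norm2_superset:
  assumes "finite K" "Poly_Mapping.keys \<mu> \<subseteq> K"
  shows "measure_norm2 \<mu> = L2_set (\<lambda>t. cmod (Poly_Mapping.lookup \<mu> t)) K"
proof -
  have "(\<Sum>t\<in>Poly_Mapping.keys \<mu>. (cmod (Poly_Mapping.lookup \<mu> t))\<^sup>2) =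
    (\<Sum>t\<in>K. (cmod (Poly_Mapping.lookup \<mu> t))\<^sup>2)"
    by (rule sum.mono_neutral_left) (use assms in \<open>auto simp: in_keys_iff\<close>)
  then show ?thesis
    by (simp add: measure_norm2_def L2_set_def)
qed

lemma measure_norm2_triangle:
  "measure_norm2 (\<mu> - \<nu>) \<le> measure_norm2 (\<kappa> - \<mu>) + measure_norm2 (\<kappa> - \<nu>)"
proof -
  define K where "K = Poly_Mapping.keys \<mu> \<union> Poly_Mapping.keys \<nu> \<union> Poly_Mapping.keys \<kappa>"
  have K: "finite K" "Poly_Mapping.keys (\<mu> - \<nu>) \<subseteq> K" "Poly_Mapping.keys (\<kappa> - \<mu>) \<subseteq> K"
    "Poly_Mapping.keys (\<kappa> - \<nu>) \<subseteq> K"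
    unfolding K_def using keys_diff[of \<mu> \<nu>] keys_diff[of \<kappa> \<mu>] keys_diff[of \<kappa> \<nu>] by auto
  have "measure_norm2 (\<mu> - \<nu>) \<le>
    L2_set (\<lambda>t. cmod (Poly_Mapping.lookup (\<kappa> - \<mu>) t) + cmod (Poly_Mapping.lookup (\<kappa> - \<nu>) t)) K"
    unfolding measure_norm2_superset[OF K(1,2)]
  proof (rule L2_set_mono)
    fix t
    show "cmod (Poly_Mapping.lookup (\<mu> - \<nu>) t) \<le>
      cmod (Poly_Mapping.lookup (\<kappa> - \<mu>) t) + cmod (Poly_Mapping.lookup (\<kappa> - \<nu>) t)"
      using norm_triangle_ineq4[of "Poly_Mapping.lookup (\<kappa> - \<nu>) t"
          "Poly_Mapping.lookup (\<kappa> - \<mu>) t"]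
      by (simp add: lookup_minus)
  qed simp
  also have "\<dots> \<le> measure_norm2 (\<kappa> - \<mu>) + measure_norm2 (\<kappa> - \<nu>)"
    unfolding measure_norm2_superset[OF K(1,3)] measure_norm2_superset[OF K(1,4)]
    by (rule L2_set_triangle_ineq)
  finally show ?thesis .
qed

lemma norm_lookup_le_measure_norm2: "cmod (Poly_Mapping.lookup \<mu> t) \<le> measure_norm2 \<mu>"
  using member_le_L2_set[of "insert t (Poly_Mapping.keys \<mu>)" t
      "\<lambda>t. cmod (Poly_Mapping.lookup \<mu> t)"]
  by (subst measure_norm2_superset[of "insert t (Poly_Mapping.keys \<mu>)"]) auto

section \<open>Square-integrable data on the band\<close>

lemma continuous_in_L2_band:
  assumes "continuous_on {-\<Omega>..\<Omega>} f"
  shows "f \<in> L2_band \<Omega>"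
proof -
  have "integrable (lebesgue_on {-\<Omega>..\<Omega>}) (\<lambda>\<omega>. (cmod (f \<omega>))\<^sup>2)"
    by (intro continuous_imp_integrable_real continuous_intros assms)
  then show ?thesis
    using borel_measurable_integrable[OF continuous_imp_integrable_real[OF assms]]
    by (simp add: L2_band_def)
qed

lemma fourier_in_L2_band: "fourier \<mu> \<in> L2_band \<Omega>"
  by (intro continuous_in_L2_band continuous_intros)

lemma L2_band_norm_continuous:
  assumes "continuous_on {-\<Omega>..\<Omega>} f"
  shows "L2_band_norm \<Omega> f = sqrt (1 / (2 * \<Omega>) * integral {-\<Omega>..\<Omega>} (\<lambda>\<omega>. (cmod (f \<omega>))\<^sup>2))"
  unfolding L2_band_norm_def
  by (subst lebesgue_integral_eq_integral)
     (use assms in \<open>auto intro!: continuous_imp_integrable_real continuous_intros\<close>)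

lemma parallelogram_bound:
  fixes x y :: "'a::real_normed_vector"
  shows "(norm (x - y))\<^sup>2 \<le> 2 * (norm x)\<^sup>2 + 2 * (norm y)\<^sup>2"
proof -
  have "(norm (x - y))\<^sup>2 \<le> (norm x + norm y)\<^sup>2"
    by (intro power_mono norm_triangle_ineq4 norm_ge_zero)
  also have "\<dots> \<le> 2 * (norm x)\<^sup>2 + 2 * (norm y)\<^sup>2"
    using sum_squares_bound[of "norm x" "norm y"] by (simp add: power2_sum)
  finally show ?thesis .
qed

text \<open>The error of two representations of the same data is compared through \<open>h\<close>, which agrees with
  their difference only almost everywhere, as data in \<open>L\<^sub>2\<close> are compared in no finer way.\<close>

lemma L2_band_norm_diff_le:
  assumes "f \<in> L2_band \<Omega>" "g \<in> L2_band \<Omega>" "0 < \<Omega>"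
    and "L2_band_norm \<Omega> f \<le> \<epsilon>" "L2_band_norm \<Omega> g \<le> \<epsilon>"
    and "h \<in> L2_band \<Omega>" "AE \<omega> in lebesgue_on {-\<Omega>..\<Omega>}. h \<omega> = f \<omega> - g \<omega>"
  shows "L2_band_norm \<Omega> h \<le> 2 * \<epsilon>"
proof -
  let ?I = "\<lambda>f. \<integral>\<omega>. (cmod (f \<omega>))\<^sup>2 \<partial>lebesgue_on {-\<Omega>..\<Omega>}"
  have i: "integrable (lebesgue_on {-\<Omega>..\<Omega>}) (\<lambda>\<omega>. (cmod (f \<omega>))\<^sup>2)"
      "integrable (lebesgue_on {-\<Omega>..\<Omega>}) (\<lambda>\<omega>. (cmod (g \<omega>))\<^sup>2)"
      "integrable (lebesgue_on {-\<Omega>..\<Omega>}) (\<lambda>\<omega>. (cmod (h \<omega>))\<^sup>2)"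
    using assms by (auto simp: L2_band_def)
  have "0 \<le> L2_band_norm \<Omega> f"
    using assms(3) by (auto simp: L2_band_norm_def)
  then have \<epsilon>: "0 \<le> \<epsilon>"
    using assms(4) by linarith
  have sq: "1 / (2 * \<Omega>) * ?I u \<le> \<epsilon>\<^sup>2" if "L2_band_norm \<Omega> u \<le> \<epsilon>" for u
    using that \<epsilon> by (simp add: L2_band_norm_def real_sqrt_le_iff sqrt_le_D)
  have "?I h \<le> (\<integral>\<omega>. 2 * (cmod (f \<omega>))\<^sup>2 + 2 * (cmod (g \<omega>))\<^sup>2 \<partial>lebesgue_on {-\<Omega>..\<Omega>})"
  proof (rule integral_mono_AE)
    show "AE \<omega> in lebesgue_on {-\<Omega>..\<Omega>}. (cmod (h \<omega>))\<^sup>2 \<le> 2 * (cmod (f \<omega>))\<^sup>2 + 2 * (cmod (g \<omega>))\<^sup>2"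
      using assms(7) by eventually_elim (metis parallelogram_bound)
  qed (use i in auto)
  also have "\<dots> = 2 * ?I f + 2 * ?I g"
    using i by simp
  finally have "1 / (2 * \<Omega>) * ?I h \<le> 1 / (2 * \<Omega>) * (2 * ?I f + 2 * ?I g)"
    by (rule mult_left_mono) (use assms(3) in simp)
  also have "\<dots> \<le> 2 * \<epsilon>\<^sup>2 + 2 * \<epsilon>\<^sup>2"
    using sq[OF assms(4)] sq[OF assms(5)] by (simp add: algebra_simps add_divide_distrib)
  finally have "1 / (2 * \<Omega>) * ?I h \<le> (2 * \<epsilon>)\<^sup>2"
    by (simp add: power_mult_distrib)
  then show ?thesis
    unfolding L2_band_norm_def using \<epsilon> by (intro real_le_lsqrt) auto
qed

section \<open>The minimax error as a modulus of stability\<close>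

text \<open>The reconstruction that attains the bound returns some measure of the class that could have
  produced the data with noise at most \<open>\<epsilon>\<close>. The true measure is another one, so their transforms
  differ by at most \<open>2 \<epsilon>\<close>. The choice is made from the set of consistent measures alone, and this set
  does not change when the data are changed on a null set.\<close>

lemma minimax_error_le:
  assumes "R \<noteq> {}" "0 < \<Omega>"
    and stable: "\<And>\<mu> \<nu>. \<mu> \<in> R \<Longrightarrow> \<nu> \<in> R \<Longrightarrow> L2_band_norm \<Omega> (fourier (\<nu> - \<mu>)) \<le> 2 * \<epsilon> \<Longrightarrow>
      measure_norm2 (\<nu> - \<mu>) \<le> B"
  shows "minimax_error R \<Omega> \<epsilon> \<le> ennreal B"
proof -
  define consistent where "consistent f = {\<nu> \<in> R. \<exists>e\<in>L2_band \<Omega>. L2_band_norm \<Omega> e \<le> \<epsilon> \<and>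
    (AE \<omega> in lebesgue_on {-\<Omega>..\<Omega>}. f \<omega> = fourier \<nu> \<omega> + e \<omega>)}" for f
  obtain \<mu>0 where \<mu>0: "\<mu>0 \<in> R"
    using assms(1) by auto
  define m where "m f = (if consistent f = {} then \<mu>0 else SOME \<nu>. \<nu> \<in> consistent f)" for f
  have m_consistent: "m f \<in> consistent f" if "consistent f \<noteq> {}" for f
    using that by (simp add: m_def some_in_eq)
  have "m f \<in> R" for f
    using m_consistent[of f] \<mu>0 by (cases "consistent f = {}") (auto simp: m_def consistent_def)
  moreover have "m f = m g" if "AE \<omega> in lebesgue_on {-\<Omega>..\<Omega>}. f \<omega> = g \<omega>" for f g
  proof -
    have "(AE \<omega> in lebesgue_on {-\<Omega>..\<Omega>}. f \<omega> = h \<omega>) \<longleftrightarrow>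
      (AE \<omega> in lebesgue_on {-\<Omega>..\<Omega>}. g \<omega> = h \<omega>)" for h
      by (rule eventually_subst) (use that in \<open>eventually_elim, simp\<close>)
    then have "consistent f = consistent g"
      by (simp add: consistent_def)
    then show ?thesis
      by (simp add: m_def)
  qed
  ultimately have m: "m \<in> reconstructions R \<Omega>"
    by (auto simp: reconstructions_def)
  have "measure_norm2 (m (\<lambda>\<omega>. fourier \<mu> \<omega> + e \<omega>) - \<mu>) \<le> B"
    if \<mu>: "\<mu> \<in> R" and e: "e \<in> L2_band \<Omega>" "L2_band_norm \<Omega> e \<le> \<epsilon>" for \<mu> e
  proof -
    let ?f = "\<lambda>\<omega>. fourier \<mu> \<omega> + e \<omega>"
    have "\<mu> \<in> consistent ?f"
      using \<mu> e by (auto simp: consistent_def)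
    then have "m ?f \<in> consistent ?f"
      using m_consistent[of ?f] by blast
    then obtain e' where e': "m ?f \<in> R" "e' \<in> L2_band \<Omega>" "L2_band_norm \<Omega> e' \<le> \<epsilon>"
      "AE \<omega> in lebesgue_on {-\<Omega>..\<Omega>}. ?f \<omega> = fourier (m ?f) \<omega> + e' \<omega>"
      by (auto simp: consistent_def)
    have "AE \<omega> in lebesgue_on {-\<Omega>..\<Omega>}. fourier (m ?f - \<mu>) \<omega> = e \<omega> - e' \<omega>"
      using e'(4) by eventually_elim (simp add: fourier_diff algebra_simps)
    then have "L2_band_norm \<Omega> (fourier (m ?f - \<mu>)) \<le> 2 * \<epsilon>"
      by (rule L2_band_norm_diff_le[OF e(1) e'(2) assms(2) e(2) e'(3) fourier_in_L2_band])
    then show ?thesis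
      by (rule stable[OF \<mu> e'(1)])
  qed
  then show ?thesis
    unfolding minimax_error_def
    by (intro INF_lower2[OF m] SUP_least ennreal_leI) auto
qed

text \<open>The noise-free data of \<open>\<mu>\<close> are at the same time admissible data of \<open>\<nu>\<close>, with noise
  \<open>fourier (\<mu> - \<nu>)\<close>. No reconstruction can be closer than half the distance to both.\<close>

lemma minimax_error_ge:
  assumes "\<mu> \<in> R" "\<nu> \<in> R" "0 \<le> \<epsilon>" "L2_band_norm \<Omega> (fourier (\<mu> - \<nu>)) \<le> \<epsilon>"
  shows "ennreal (measure_norm2 (\<mu> - \<nu>) / 2) \<le> minimax_error R \<Omega> \<epsilon>"
  unfolding minimax_error_def
proof (rule INF_greatest)
  fix m
  assume "m \<in> reconstructions R \<Omega>"
  let ?E = "{e \<in> L2_band \<Omega>. L2_band_norm \<Omega> e \<le> \<epsilon>}"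
  let ?err = "\<lambda>\<kappa> e. ennreal (measure_norm2 (m (\<lambda>\<omega>. fourier \<kappa> \<omega> + e \<omega>) - \<kappa>))"
  let ?\<kappa> = "m (fourier \<mu>)"
  have "(\<lambda>\<omega>. 0) \<in> ?E"
    using assms(3) by (auto simp: L2_band_def L2_band_norm_def)
  then have "?err \<mu> (\<lambda>\<omega>. 0) \<le> (SUP \<mu>\<in>R. SUP e\<in>?E. ?err \<mu> e)"
    using assms(1) by (meson SUP_upper SUP_upper2)
  moreover have "fourier (\<mu> - \<nu>) \<in> ?E"
    using assms(4) by (auto simp: fourier_in_L2_band)
  then have "?err \<nu> (fourier (\<mu> - \<nu>)) \<le> (SUP \<mu>\<in>R. SUP e\<in>?E. ?err \<mu> e)"
    using assms(2) by (meson SUP_upper SUP_upper2)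
  ultimately have "ennreal (measure_norm2 (?\<kappa> - \<mu>)) \<le> (SUP \<mu>\<in>R. SUP e\<in>?E. ?err \<mu> e)"
    "ennreal (measure_norm2 (?\<kappa> - \<nu>)) \<le> (SUP \<mu>\<in>R. SUP e\<in>?E. ?err \<mu> e)"
    by (simp_all add: fourier_diff)
  moreover have "measure_norm2 (\<mu> - \<nu>) / 2 \<le> measure_norm2 (?\<kappa> - \<mu>) \<or>
    measure_norm2 (\<mu> - \<nu>) / 2 \<le> measure_norm2 (?\<kappa> - \<nu>)"
    using measure_norm2_triangle[of \<mu> \<nu> ?\<kappa>] by linarith
  ultimately show "ennreal (measure_norm2 (\<mu> - \<nu>) / 2) \<le> (SUP \<mu>\<in>R. SUP e\<in>?E. ?err \<mu> e)"
    by (meson ennreal_leI order_trans)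
qed

lemma minimax_error_empty: "minimax_error {} \<Omega> \<epsilon> = top"
proof -
  have "fourier 0 \<in> L2_band \<Omega>"
    by (rule fourier_in_L2_band)
  then have "reconstructions {} \<Omega> = {}"
    by (auto simp: reconstructions_def)
  then show ?thesis
    by (simp add: minimax_error_def)
qed

section \<open>Recovering one amplitude of an exponential sum\<close>

text \<open>Each \<open>u \<in> U\<close> is treated by one difference \<open>G(\<omega>) - exp (- \<i> (\<theta> u) u) G(\<omega> + \<theta> u)\<close>. Its squared
  integral is at most four times that of \<open>G\<close> over the interval prolonged by \<open>\<theta> u\<close>. For \<open>t \<in> U\<close> the
  product vanishes, so the sum on the left has lost all the nodes in \<open>U\<close>.\<close>

lemma annihilated_exponential_sum_bound:
  fixes a :: "real \<Rightarrow> complex" and \<theta> :: "real \<Rightarrow> real"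
  assumes "finite U" "\<And>u. u \<in> U \<Longrightarrow> 0 \<le> \<theta> u"
  shows "integral {c..d} (\<lambda>\<omega>. (cmod (\<Sum>t\<in>T. a t *
        (\<Prod>u\<in>U. 1 - exp (\<i> * complex_of_real (\<theta> u * (t - u)))) *
        exp (\<i> * complex_of_real (\<omega> * t))))\<^sup>2)
    \<le> 4 ^ card U * integral {c..d + sum \<theta> U}
        (\<lambda>\<omega>. (cmod (\<Sum>t\<in>T. a t * exp (\<i> * complex_of_real (\<omega> * t))))\<^sup>2)"
  using assms
proof (induction U arbitrary: d rule: finite_induct)
  case empty
  then show ?case by simp
next
  case (insert v U)
  let ?P = "\<lambda>U t. \<Prod>u\<in>U. 1 - exp (\<i> * complex_of_real (\<theta> u * (t - u)))"
  define G where "G \<omega> = (\<Sum>t\<in>T. a t * ?P U t * exp (\<i> * complex_of_real (\<omega> * t)))" for \<omega>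
  have cont [continuous_intros]: "continuous_on A (\<lambda>\<omega>. (cmod (G \<omega>))\<^sup>2)" for A
    unfolding G_def by (intro continuous_intros)
  have cont' [continuous_intros]: "continuous_on A (\<lambda>\<omega>. (cmod (G (\<theta> v + \<omega>)))\<^sup>2)" for A
    unfolding G_def by (intro continuous_intros)
  have v: "0 \<le> \<theta> v"
    using insert.prems by auto
  have step: "(\<Sum>t\<in>T. a t * ?P (insert v U) t * exp (\<i> * complex_of_real (\<omega> * t))) =
    G \<omega> - exp (- (\<i> * complex_of_real (\<theta> v * v))) * G (\<theta> v + \<omega>)" for \<omega>
    unfolding G_def sum_distrib_left sum_subtractf[symmetric]
  proof (rule sum.cong)
    fix t
    have e: "exp (\<i> * complex_of_real (\<theta> v * (t - v))) * exp (\<i> * complex_of_real (\<omega> * t)) =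
      exp (- (\<i> * complex_of_real (\<theta> v * v))) * exp (\<i> * complex_of_real ((\<theta> v + \<omega>) * t))"
      by (simp add: exp_add[symmetric] algebra_simps)
    have "a t * ?P (insert v U) t * exp (\<i> * complex_of_real (\<omega> * t)) =
      a t * ?P U t * exp (\<i> * complex_of_real (\<omega> * t)) - a t * ?P U t *
      (exp (\<i> * complex_of_real (\<theta> v * (t - v))) * exp (\<i> * complex_of_real (\<omega> * t)))"
      using insert.hyps by (simp add: algebra_simps)
    then show "a t * ?P (insert v U) t * exp (\<i> * complex_of_real (\<omega> * t)) =
      a t * ?P U t * exp (\<i> * complex_of_real (\<omega> * t)) -
      exp (- (\<i> * complex_of_real (\<theta> v * v))) *
        (a t * ?P U t * exp (\<i> * complex_of_real ((\<theta> v + \<omega>) * t)))"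
      unfolding e by (simp add: mult_ac)
  qed simp
  have "integral {c..d} (\<lambda>\<omega>. (cmod (G \<omega> - exp (- (\<i> * complex_of_real (\<theta> v * v))) *
      G (\<theta> v + \<omega>)))\<^sup>2) \<le>
    integral {c..d} (\<lambda>\<omega>. 2 * (cmod (G \<omega>))\<^sup>2 + 2 * (cmod (G (\<theta> v + \<omega>)))\<^sup>2)"
  proof (rule integral_le)
    show "(\<lambda>\<omega>. (cmod (G \<omega> - exp (- (\<i> * complex_of_real (\<theta> v * v))) *
      G (\<theta> v + \<omega>)))\<^sup>2) integrable_on {c..d}"
      unfolding G_def by (intro integrable_continuous_interval continuous_intros)
    show "(\<lambda>\<omega>. 2 * (cmod (G \<omega>))\<^sup>2 + 2 * (cmod (G (\<theta> v + \<omega>)))\<^sup>2) integrable_on {c..d}"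
      by (intro integrable_continuous_interval continuous_intros)
  next
    fix \<omega>
    have "cmod (exp (- (\<i> * complex_of_real (\<theta> v * v)))) = 1"
      by simp
    then show "(cmod (G \<omega> - exp (- (\<i> * complex_of_real (\<theta> v * v))) * G (\<theta> v + \<omega>)))\<^sup>2 \<le>
        2 * (cmod (G \<omega>))\<^sup>2 + 2 * (cmod (G (\<theta> v + \<omega>)))\<^sup>2"
      using parallelogram_bound[of "G \<omega>"
          "exp (- (\<i> * complex_of_real (\<theta> v * v))) * G (\<theta> v + \<omega>)"]
      by (simp only: norm_mult mult_1)
  qed
  also have "\<dots> = 2 * integral {c..d} (\<lambda>\<omega>. (cmod (G \<omega>))\<^sup>2) +
      2 * integral {c..d} (\<lambda>\<omega>. (cmod (G (\<theta> v + \<omega>)))\<^sup>2)"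
    by (subst Henstock_Kurzweil_Integration.integral_add)
       (auto intro!: integrable_continuous_interval continuous_intros)
  also have "integral {c..d} (\<lambda>\<omega>. (cmod (G (\<theta> v + \<omega>)))\<^sup>2) =
      integral {c + \<theta> v..d + \<theta> v} (\<lambda>\<omega>. (cmod (G \<omega>))\<^sup>2)"
    using integral_shift_Icc_real[of c d "\<lambda>\<omega>. (cmod (G \<omega>))\<^sup>2" "\<theta> v"] by (simp add: o_def)
  also have "2 * integral {c..d} (\<lambda>\<omega>. (cmod (G \<omega>))\<^sup>2) +
      2 * integral {c + \<theta> v..d + \<theta> v} (\<lambda>\<omega>. (cmod (G \<omega>))\<^sup>2) \<le>
      2 * integral {c..d + \<theta> v} (\<lambda>\<omega>. (cmod (G \<omega>))\<^sup>2) +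
      2 * integral {c..d + \<theta> v} (\<lambda>\<omega>. (cmod (G \<omega>))\<^sup>2)"
    by (intro add_mono mult_left_mono integral_subset_le)
       (use v in \<open>auto intro!: integrable_continuous_interval continuous_intros\<close>)
  also have "\<dots> = 4 * integral {c..d + \<theta> v} (\<lambda>\<omega>. (cmod (G \<omega>))\<^sup>2)"
    by simp
  also have "\<dots> \<le> 4 * (4 ^ card U * integral {c..d + \<theta> v + sum \<theta> U}
        (\<lambda>\<omega>. (cmod (\<Sum>t\<in>T. a t * exp (\<i> * complex_of_real (\<omega> * t))))\<^sup>2))"
    unfolding G_def by (rule mult_left_mono[OF insert.IH]) (use insert.prems in auto)
  finally show ?case
    unfolding step using insert.hyps by (simp add: add.assoc)
qed

text \<open>Up to a half turn, the chord \<open>2 sin (x / 2)\<close> is at least \<open>2 / pi\<close> times the arc \<open>x\<close>, by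
  concavity of the sine.\<close>

lemma chord_le_norm_exp_diff:
  assumes "0 \<le> x" "x \<le> pi"
  shows "2 * x / pi \<le> cmod (1 - exp (\<i> * complex_of_real x))"
proof -
  have "convex_on {0..pi/2} (\<lambda>x. - sin x)"
    by (rule f''_ge0_imp_convex[where f' = "\<lambda>x. - cos x" and f'' = sin])
       (auto intro!: derivative_eq_intros sin_ge_zero)
  from convex_onD_Icc'[OF this, of "x/2"] have "x / pi \<le> sin (x / 2)"
    using assms by simp
  then show ?thesis
    using dist_exp_i_1[of x] by (simp add: norm_minus_commute)
qed

lemma norm_exp_diff_le: "cmod (1 - exp (\<i> * complex_of_real x)) \<le> \<bar>x\<bar>"
  using dist_exp_i_1[of x] abs_sin_x_le_abs_x[of "x/2"] by (simp add: norm_minus_commute)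

text \<open>All nodes other than \<open>t\<close> are annihilated. There are fewer than \<open>N\<close> of them and each shift is at
  most \<open>\<Omega> / N\<close>, so the left half of the band moves inside the band. The base \<open>2 \<Omega> \<Delta> / (pi N)\<close> bounds
  from below the multiplier of a close node, whose phase \<open>(\<Omega> / N) \<bar>t - u\<bar>\<close> lies between \<open>\<Omega> \<Delta> / N\<close> and
  \<open>pi\<close>. A far node would have a larger phase, and its shift is shortened to make the phase \<open>pi\<close>.\<close>

lemma amplitude_bound:
  fixes a :: "real \<Rightarrow> complex"
  assumes T: "finite T" "card T \<le> N" "t \<in> T"
    and pos: "0 < \<Omega>" "0 < \<Delta>"
    and sep: "\<And>u. u \<in> T \<Longrightarrow> u \<noteq> t \<Longrightarrow> \<Delta> \<le> \<bar>t - u\<bar>"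
    and coarse: "2 * \<Omega> * \<Delta> \<le> pi * N"
    and close: "card {u \<in> T - {t}. \<Omega> * \<bar>t - u\<bar> \<le> pi * N} \<le> n"
  shows "\<Omega> * (cmod (a t) * (2 * \<Omega> * \<Delta> / (pi * N)) ^ n)\<^sup>2 \<le>
    4 ^ N * integral {-\<Omega>..\<Omega>} (\<lambda>\<omega>. (cmod (\<Sum>t\<in>T. a t * exp (\<i> * complex_of_real (\<omega> * t))))\<^sup>2)"
proof -
  define q where "q = 2 * \<Omega> * \<Delta> / (pi * N)"
  define U where "U = T - {t}"
  define V where "V = {u \<in> U. \<Omega> * \<bar>t - u\<bar> \<le> pi * N}"
  define \<theta> where "\<theta> u = (if u \<in> V then \<Omega> / N else pi / \<bar>t - u\<bar>)" for u
  let ?F = "\<lambda>\<omega>. (cmod (\<Sum>t\<in>T. a t * exp (\<i> * complex_of_real (\<omega> * t))))\<^sup>2"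
  let ?P = "\<lambda>t. \<Prod>u\<in>U. 1 - exp (\<i> * complex_of_real (\<theta> u * (t - u)))"
  have N: "0 < N"
    using T by (metis card_gt_0_iff empty_iff gr0I le_zero_eq not_gr0)
  have q: "0 < q" "q \<le> 1"
    using pos N coarse by (auto simp: q_def)
  have finU: "finite U" "card U \<le> N"
    using T card_Diff_subset[of "{t}" T] by (auto simp: U_def)
  have finV: "finite V" "V \<subseteq> U" "card V \<le> n"
    using finU close by (auto simp: V_def U_def)
  have cases: "0 \<le> \<theta> u \<and> \<theta> u \<le> \<Omega> / N \<and>
      (if u \<in> V then q else 1) \<le> cmod (1 - exp (\<i> * complex_of_real (\<theta> u * (t - u))))"
    if "u \<in> U" for u
  proof -
    have d: "\<Delta> \<le> \<bar>t - u\<bar>"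
      using sep that by (auto simp: U_def)
    \<comment> \<open>The modulus depends on the distance only, and all estimates are in terms of \<open>\<bar>t - u\<bar>\<close>.\<close>
    have sym: "cmod (1 - exp (\<i> * complex_of_real (\<theta> u * (t - u)))) =
      cmod (1 - exp (\<i> * complex_of_real (\<theta> u * \<bar>t - u\<bar>)))"
    proof (cases "0 \<le> t - u")
      case False
      then have e: "\<theta> u * \<bar>t - u\<bar> = - (\<theta> u * (t - u))"
        by (simp add: algebra_simps)
      have s: "cmod (1 - exp (\<i> * complex_of_real x)) = 2 * \<bar>sin (x / 2)\<bar>" for x
        using dist_exp_i_1[of x] by (simp only: norm_minus_commute)
      show ?thesis
        unfolding s e by simp
    qed simp
    show ?thesis
    proof (cases "u \<in> V")
      case True
      have "2 * (\<theta> u * \<bar>t - u\<bar>) / pi \<le> cmod (1 - exp (\<i> * complex_of_real (\<theta> u * \<bar>t - u\<bar>)))"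
        by (rule chord_le_norm_exp_diff)
           (use True pos N in \<open>auto simp: \<theta>_def V_def field_simps\<close>)
      moreover have "q \<le> 2 * (\<theta> u * \<bar>t - u\<bar>) / pi"
        using True d pos N by (simp add: q_def \<theta>_def field_simps)
      ultimately show ?thesis
        unfolding sym using True pos by (auto simp: \<theta>_def)
    next
      case False
      then have far: "pi * N < \<Omega> * \<bar>t - u\<bar>"
        using that by (auto simp: V_def)
      have "\<theta> u * \<bar>t - u\<bar> = pi"
        using False d pos by (simp add: \<theta>_def)
      then have "1 \<le> cmod (1 - exp (\<i> * complex_of_real (\<theta> u * \<bar>t - u\<bar>)))"
        by simp
      moreover have "pi / \<bar>t - u\<bar> \<le> \<Omega> / N"
        using far d pos N by (simp add: field_simps)
      ultimately show ?thesis
        unfolding sym using False by (auto simp: \<theta>_def)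
    qed
  qed
  have "sum \<theta> U \<le> (\<Sum>u\<in>U. \<Omega> / N)"
    by (rule sum_mono) (use cases in blast)
  also have "\<dots> \<le> \<Omega>"
    using finU(2) pos N by (simp add: field_simps)
  finally have sum: "sum \<theta> U \<le> \<Omega>" .
  have "q ^ n \<le> q ^ card V"
    using q finV by (intro power_decreasing) auto
  also have "\<dots> = (\<Prod>u\<in>U. if u \<in> V then q else 1)"
    using finU(1) finV(2) by (simp add: prod.If_cases Int_absorb1)
  also have "\<dots> \<le> cmod (?P t)"
    unfolding prod_norm[symmetric] by (rule prod_mono) (use cases q in auto)
  finally have P: "q ^ n \<le> cmod (?P t)" .
  have kill: "(\<Sum>k\<in>T. a k * ?P k * exp (\<i> * complex_of_real (\<omega> * k))) =
    a t * ?P t * exp (\<i> * complex_of_real (\<omega> * t))" for \<omega>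
  proof -
    have "?P k = 0" if "k \<in> T - {t}" for k
      using that finU(1) by (intro prod_zero) (auto simp: U_def intro!: bexI[of _ k])
    then show ?thesis
      using T by (subst sum.remove[of T t]) auto
  qed
  have "\<Omega> * (cmod (a t) * q ^ n)\<^sup>2 \<le> \<Omega> * (cmod (a t) * cmod (?P t))\<^sup>2"
    using P pos q by (intro mult_left_mono power_mono) auto
  also have "\<dots> = integral {-\<Omega>..0} (\<lambda>\<omega>. (cmod (\<Sum>k\<in>T. a k * ?P k *
      exp (\<i> * complex_of_real (\<omega> * k))))\<^sup>2)"
    unfolding kill using pos by (simp add: norm_mult)
  also have "\<dots> \<le> 4 ^ card U * integral {-\<Omega>..0 + sum \<theta> U} ?F"
    by (rule annihilated_exponential_sum_bound) (use cases finU in auto)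
  also have "\<dots> \<le> 4 ^ N * integral {-\<Omega>..\<Omega>} ?F"
    by (intro mult_mono power_increasing integral_subset_le)
       (use sum finU in \<open>auto intro!: integrable_continuous_interval continuous_intros integral_nonneg\<close>)
  finally show ?thesis
    by (simp add: q_def)
qed


section \<open>Clustered configurations on the grid\<close>

lemma wrap_norm_diff:
  assumes "x \<in> {-(pi/2)<..pi/2}" "y \<in> {-(pi/2)<..pi/2}"
  shows "wrap_norm (x - y) = \<bar>x - y\<bar>"
  using assms by (auto simp: wrap_norm_def Arg_exp)

lemma grid_separated:
  assumes "x \<in> grid \<Delta>" "y \<in> grid \<Delta>" "x \<noteq> y" "0 < \<Delta>"
  shows "\<Delta> \<le> \<bar>x - y\<bar>"
proof -
  obtain i j :: int where ij: "x = of_int i * \<Delta>" "y = of_int j * \<Delta>"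
    using assms by (auto simp: grid_def)
  then have "1 \<le> \<bar>i - j\<bar>"
    using assms(3) by auto
  then have "1 \<le> \<bar>real_of_int i - of_int j\<bar>"
    by (metis of_int_1_le_iff of_int_abs of_int_diff)
  then have "1 * \<Delta> \<le> \<bar>real_of_int i - of_int j\<bar> * \<Delta>"
    using assms(4) by (intro mult_right_mono) auto
  then show ?thesis
    using assms(4) by (simp add: ij abs_mult flip: left_diff_distrib)
qed

lemma finite_grid: "finite (grid \<Delta>)"
proof -
  have "grid \<Delta> = (\<lambda>k. of_int k * \<Delta>) ` {- \<lfloor>pi / (2 * \<Delta>)\<rfloor>..\<lfloor>pi / (2 * \<Delta>)\<rfloor>}"
    by (auto simp: grid_def)
  then show ?thesis
    by simp
qed

lemma grid_memberI:
  assumes "0 < \<Delta>" "\<bar>of_int k * \<Delta>\<bar> < pi / 2"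
  shows "of_int k * \<Delta> \<in> grid \<Delta> \<inter> {-(pi/2)<..pi/2}"
proof -
  have "\<bar>of_int k\<bar> \<le> pi / (2 * \<Delta>)"
    using assms by (simp add: field_simps abs_mult)
  then have "of_int k \<le> pi / (2 * \<Delta>)" "of_int (- k) \<le> pi / (2 * \<Delta>)"
    by auto
  then have "k \<le> \<lfloor>pi / (2 * \<Delta>)\<rfloor>" "- k \<le> \<lfloor>pi / (2 * \<Delta>)\<rfloor>"
    by (simp_all add: le_floor_iff)
  then show ?thesis
    using assms(2) by (auto simp: grid_def abs_less_iff)
qed

text \<open>Nodes in \<open>{-(pi/2)<..pi/2}\<close> are less than \<open>pi\<close> apart, so their wrap-around distance is the
  usual one, and only the set \<open>S\<close> of nodes matters, not their enumeration. Nodes may have mass zero,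
  hence an inclusion instead of an equality between the support and \<open>S\<close>.\<close>

lemma cluster_measures_iff:
  "\<mu> \<in> cluster_measures \<Delta> \<rho> s l \<tau> \<longleftrightarrow>
    (\<exists>S. finite S \<and> card S = s \<and> S \<subseteq> grid \<Delta> \<inter> {-(pi/2)<..pi/2} \<and> Poly_Mapping.keys \<mu> \<subseteq> S \<and>
      (\<forall>x\<in>S. \<exists>Y. Y \<subseteq> S \<and> x \<in> Y \<and> card Y \<le> l \<and>
        (\<forall>y\<in>Y - {x}. \<Delta> \<le> \<bar>y - x\<bar> \<and> \<bar>y - x\<bar> \<le> \<tau> * \<Delta>) \<and> (\<forall>y\<in>S - Y. \<rho> \<le> \<bar>y - x\<bar>)))"
    (is "_ \<longleftrightarrow> (\<exists>S. ?config S)")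
proof
  assume "\<mu> \<in> cluster_measures \<Delta> \<rho> s l \<tau>"
  then obtain t a where \<mu>: "\<mu> = (\<Sum>j = 1..s. Poly_Mapping.single (t j) (a j))"
    and grid: "t ` {1..s} \<subseteq> grid \<Delta>" and t: "clustered_configuration \<Delta> \<rho> s l \<tau> t"
    by (auto simp: cluster_measures_def)
  let ?S = "t ` {1..s}"
  have S: "?S \<subseteq> {-(pi/2)<..pi/2}" and inj: "inj_on t {1..s}"
    using t by (auto simp: clustered_configuration_def)
  have "Poly_Mapping.keys \<mu> \<subseteq> (\<Union>j\<in>{1..s}. Poly_Mapping.keys (Poly_Mapping.single (t j) (a j)))"
    unfolding \<mu> by (rule keys_sum)
  also have "\<dots> \<subseteq> ?S"
    by (auto split: if_splits)
  finally have keys: "Poly_Mapping.keys \<mu> \<subseteq> ?S" .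
  have "\<forall>x\<in>?S. \<exists>Y. Y \<subseteq> ?S \<and> x \<in> Y \<and> card Y \<le> l \<and>
      (\<forall>y\<in>Y - {x}. \<Delta> \<le> \<bar>y - x\<bar> \<and> \<bar>y - x\<bar> \<le> \<tau> * \<Delta>) \<and> (\<forall>y\<in>?S - Y. \<rho> \<le> \<bar>y - x\<bar>)"
    (is "Ball _ ?clustered")
  proof
    fix x
    assume x: "x \<in> ?S"
    then obtain j where j: "j \<in> {1..s}" "x = t j"
      by (rule imageE)
    from t have "\<forall>j\<in>{1..s}. \<exists>Y. Y \<subseteq> ?S \<and> t j \<in> Y \<and> card Y \<le> l \<and>
      (\<forall>y\<in>Y - {t j}. \<Delta> \<le> wrap_norm (y - t j) \<and> wrap_norm (y - t j) \<le> \<tau> * \<Delta>) \<and>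
      (\<forall>y\<in>?S - Y. \<rho> \<le> wrap_norm (y - t j))"
      unfolding clustered_configuration_def by (elim conjE)
    from bspec[OF this j(1)] obtain Y where Y: "Y \<subseteq> ?S" "x \<in> Y" "card Y \<le> l"
      "\<forall>y\<in>Y - {x}. \<Delta> \<le> wrap_norm (y - x) \<and> wrap_norm (y - x) \<le> \<tau> * \<Delta>"
      "\<forall>y\<in>?S - Y. \<rho> \<le> wrap_norm (y - x)"
      unfolding j(2)[symmetric] by (elim exE conjE)
    have dist: "wrap_norm (y - x) = \<bar>y - x\<bar>" if "y \<in> ?S" for y
      using S x that by (intro wrap_norm_diff) auto
    moreover have "wrap_norm (y - x) = \<bar>y - x\<bar>" if "y \<in> Y" for y
      using dist Y(1) that by auto
    ultimately show "?clustered x"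
      using Y by (intro exI[of _ Y]) simp
  qed
  moreover have "card ?S = s"
    using card_image[OF inj] by simp
  ultimately have "?config ?S"
    using S grid keys by (intro conjI Int_greatest finite_imageI finite_atLeastAtMost)
  then show "\<exists>S. ?config S"
    by (intro exI[of _ ?S])
next
  assume "\<exists>S. ?config S"
  then obtain S where fin: "finite S" and card: "card S = s"
    and S: "S \<subseteq> grid \<Delta> \<inter> {-(pi/2)<..pi/2}" and keys: "Poly_Mapping.keys \<mu> \<subseteq> S"
    and clustered: "\<forall>x\<in>S. \<exists>Y. Y \<subseteq> S \<and> x \<in> Y \<and> card Y \<le> l \<and>
      (\<forall>y\<in>Y - {x}. \<Delta> \<le> \<bar>y - x\<bar> \<and> \<bar>y - x\<bar> \<le> \<tau> * \<Delta>) \<and> (\<forall>y\<in>S - Y. \<rho> \<le> \<bar>y - x\<bar>)"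
    by (elim exE conjE)
  from fin card obtain t where t: "bij_betw t {1..s} S"
    using ex_bij_betw_nat_finite_1 by blast
  then have im: "t ` {1..s} = S" and inj: "inj_on t {1..s}"
    by (auto simp: bij_betw_def)
  have "\<mu> = (\<Sum>x\<in>S. Poly_Mapping.single x (Poly_Mapping.lookup \<mu> x))"
  proof (rule poly_mapping_eqI)
    fix x
    have "Poly_Mapping.lookup (\<Sum>x\<in>S. Poly_Mapping.single x (Poly_Mapping.lookup \<mu> x)) x =
      (\<Sum>y\<in>S. if y = x then Poly_Mapping.lookup \<mu> y else 0)"
      by (auto simp: lookup_sum lookup_single when_def intro: sum.cong)
    then show "Poly_Mapping.lookup \<mu> x =
      Poly_Mapping.lookup (\<Sum>x\<in>S. Poly_Mapping.single x (Poly_Mapping.lookup \<mu> x)) x"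
      using keys fin by (auto simp: in_keys_iff)
  qed
  also have "\<dots> = (\<Sum>j = 1..s. Poly_Mapping.single (t j) (Poly_Mapping.lookup \<mu> (t j)))"
    by (rule sum.reindex_bij_betw[OF t, symmetric])
  finally have \<mu>: "\<mu> = (\<Sum>j = 1..s. Poly_Mapping.single (t j) (Poly_Mapping.lookup \<mu> (t j)))" .
  have "clustered_configuration \<Delta> \<rho> s l \<tau> t"
    unfolding clustered_configuration_def im
  proof (intro conjI ballI)
    fix j
    assume "j \<in> {1..s}"
    then have x: "t j \<in> S"
      using im by auto
    have dist: "wrap_norm (y - t j) = \<bar>y - t j\<bar>" if "y \<in> S" for y
      using S x that by (intro wrap_norm_diff) auto
    from bspec[OF clustered x] obtain Y where Y: "Y \<subseteq> S" "t j \<in> Y" "card Y \<le> l"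
      "\<forall>y\<in>Y - {t j}. \<Delta> \<le> \<bar>y - t j\<bar> \<and> \<bar>y - t j\<bar> \<le> \<tau> * \<Delta>" "\<forall>y\<in>S - Y. \<rho> \<le> \<bar>y - t j\<bar>"
      by (elim exE conjE)
    show "\<exists>Y\<subseteq>S. t j \<in> Y \<and> card Y \<le> l \<and>
        (\<forall>y\<in>Y - {t j}. \<Delta> \<le> wrap_norm (y - t j) \<and> wrap_norm (y - t j) \<le> \<tau> * \<Delta>) \<and>
        (\<forall>y\<in>S - Y. \<rho> \<le> wrap_norm (y - t j))"
      using Y by (intro exI[of _ Y]) (simp add: dist subsetD[OF Y(1)])
  qed (use S inj in auto)
  moreover have "t ` {1..s} \<subseteq> grid \<Delta>"
    unfolding im using S by simp
  ultimately show "\<mu> \<in> cluster_measures \<Delta> \<rho> s l \<tau>"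
    unfolding cluster_measures_def mem_Collect_eq using \<mu>
    by (intro exI[of _ t] exI[of _ "\<lambda>j. Poly_Mapping.lookup \<mu> (t j)"] conjI)
qed

lemma cluster_measures_support:
  assumes "\<mu> \<in> cluster_measures \<Delta> \<rho> s l \<tau>"
  obtains A where "finite A" "card A = s" "A \<subseteq> grid \<Delta>" "Poly_Mapping.keys \<mu> \<subseteq> A"
    "\<And>x. x \<in> A \<Longrightarrow> \<exists>Y. Y \<subseteq> A \<and> card Y \<le> l \<and> (\<forall>y\<in>A - Y. \<rho> \<le> \<bar>y - x\<bar>)"
proof -
  from assms obtain A where A: "finite A" "card A = s" "A \<subseteq> grid \<Delta> \<inter> {-(pi/2)<..pi/2}"
    "Poly_Mapping.keys \<mu> \<subseteq> A"
    and Y: "\<forall>x\<in>A. \<exists>Y. Y \<subseteq> A \<and> x \<in> Y \<and> card Y \<le> l \<and>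
      (\<forall>y\<in>Y - {x}. \<Delta> \<le> \<bar>y - x\<bar> \<and> \<bar>y - x\<bar> \<le> \<tau> * \<Delta>) \<and> (\<forall>y\<in>A - Y. \<rho> \<le> \<bar>y - x\<bar>)"
    unfolding cluster_measures_iff by (elim exE conjE)
  from Y have "\<exists>Y. Y \<subseteq> A \<and> card Y \<le> l \<and> (\<forall>y\<in>A - Y. \<rho> \<le> \<bar>y - x\<bar>)" if "x \<in> A" for x
    using that by meson
  with A show ?thesis
    by (intro that) auto
qed

section \<open>Stability of clustered measures\<close>

text \<open>Two points of the ball are less than \<open>\<rho>\<close> apart, so all points of \<open>A\<close> in the ball belong to the
  cluster of any one of them. The centre is arbitrary, because it will be a node of one measure while
  \<open>A\<close> carries the other.\<close>

lemma card_ball_le: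
  fixes A :: "real set"
  assumes "finite A" "\<And>x. x \<in> A \<Longrightarrow> \<exists>Y. Y \<subseteq> A \<and> card Y \<le> l \<and> (\<forall>y\<in>A - Y. \<rho> \<le> \<bar>y - x\<bar>)"
  shows "card {y \<in> A. \<bar>y - t\<bar> < \<rho> / 2} \<le> l"
proof (cases "{y \<in> A. \<bar>y - t\<bar> < \<rho> / 2} = {}")
  case False
  then obtain x where x: "x \<in> A" "\<bar>x - t\<bar> < \<rho> / 2"
    by auto
  then obtain Y where Y: "Y \<subseteq> A" "card Y \<le> l" "\<forall>y\<in>A - Y. \<rho> \<le> \<bar>y - x\<bar>"
    using assms(2) by blast
  have "y \<in> Y" if "y \<in> A" "\<bar>y - t\<bar> < \<rho> / 2" for y
  proof (rule ccontr)
    assume "y \<notin> Y"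
    then have "\<rho> \<le> \<bar>y - x\<bar>"
      using Y that by auto
    then show False
      using that x by linarith
  qed
  then have "{y \<in> A. \<bar>y - t\<bar> < \<rho> / 2} \<subseteq> Y"
    by auto
  then have "card {y \<in> A. \<bar>y - t\<bar> < \<rho> / 2} \<le> card Y"
    using Y assms(1) by (intro card_mono) (auto intro: finite_subset)
  then show ?thesis
    using Y by linarith
next
  case True
  then show ?thesis
    by (simp only: card.empty)
qed

text \<open>Every amplitude of \<open>\<nu> - \<mu>\<close> is estimated by \<open>amplitude_bound\<close> with \<open>N = 2 s\<close> and \<open>n = 2 l - 1\<close>. The
  close nodes are those at distance at most \<open>2 pi s / \<Omega>\<close>. If \<open>4 pi s < \<Omega> \<rho>\<close>, this is less than
  \<open>\<rho> / 2\<close>, and a ball of that radius has at most \<open>l\<close> nodes of each measure. If \<open>l = s\<close>, all \<open>2 s\<close> nodes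
  may be close, which is no more than \<open>2 l\<close>.\<close>

lemma cluster_measures_stable:
  assumes R: "\<mu> \<in> cluster_measures \<Delta> \<rho> s l \<tau>" "\<nu> \<in> cluster_measures \<Delta> \<rho> s l \<tau>"
    and pos: "0 < \<Delta>" "0 < \<Omega>" "0 \<le> \<epsilon>" "1 \<le> s" "1 \<le> l"
    and srf: "1 \<le> SRF \<Delta> \<Omega>"
    and far: "4 * pi * s < \<Omega> * \<rho> \<or> l = s"
    and small: "L2_band_norm \<Omega> (fourier (\<nu> - \<mu>)) \<le> 2 * \<epsilon>"
  shows "measure_norm2 (\<nu> - \<mu>) \<le> 4 ^ (s + 1) * real s ^ (2 * l) * SRF \<Delta> \<Omega> ^ (2 * l - 1) * \<epsilon>"
proof -
  obtain A where A: "finite A" "card A = s" "A \<subseteq> grid \<Delta>" "Poly_Mapping.keys \<mu> \<subseteq> A"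
    "\<And>x. x \<in> A \<Longrightarrow> \<exists>Y. Y \<subseteq> A \<and> card Y \<le> l \<and> (\<forall>y\<in>A - Y. \<rho> \<le> \<bar>y - x\<bar>)"
    using cluster_measures_support[OF R(1)] by metis
  obtain B where B: "finite B" "card B = s" "B \<subseteq> grid \<Delta>" "Poly_Mapping.keys \<nu> \<subseteq> B"
    "\<And>x. x \<in> B \<Longrightarrow> \<exists>Y. Y \<subseteq> B \<and> card Y \<le> l \<and> (\<forall>y\<in>B - Y. \<rho> \<le> \<bar>y - x\<bar>)"
    using cluster_measures_support[OF R(2)] by metis
  define T where "T = A \<union> B"
  have T: "finite T" "card T \<le> 2 * s" "Poly_Mapping.keys (\<nu> - \<mu>) \<subseteq> T"
    using A B card_Un_le[of A B] keys_diff[of \<nu> \<mu>] by (auto simp: T_def)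
  define q where "q = 1 / (s * SRF \<Delta> \<Omega>)"
  have q: "2 * \<Omega> * \<Delta> / (pi * real (2 * s)) = q"
    using pos by (simp add: q_def SRF_def field_simps)
  let ?a = "Poly_Mapping.lookup (\<nu> - \<mu>)"
  let ?J = "integral {-\<Omega>..\<Omega>} (\<lambda>\<omega>. (cmod (fourier (\<nu> - \<mu>) \<omega>))\<^sup>2)"
  have "1 / (2 * \<Omega>) * ?J \<le> (2 * \<epsilon>)\<^sup>2"
    using small
    by (intro sqrt_le_D) (simp only: L2_band_norm_continuous[OF continuous_on_fourier])
  then have J: "?J \<le> 8 * \<Omega> * \<epsilon>\<^sup>2"
    using pos by (simp add: field_simps)
  have amplitude: "(cmod (?a t) * q ^ (2 * l - 1))\<^sup>2 \<le> 8 * 4 ^ (2 * s) * \<epsilon>\<^sup>2" if t: "t \<in> T" for t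
  proof -
    have "card {u \<in> T - {t}. \<Omega> * \<bar>t - u\<bar> \<le> pi * real (2 * s)} \<le> 2 * l - 1" (is "card ?U \<le> _")
    proof (cases "l = s")
      case True
      have "card ?U \<le> card (T - {t})"
        using T by (intro card_mono) auto
      then show ?thesis
        using True T t by simp
    next
      case False
      then have gap: "4 * pi * s < \<Omega> * \<rho>"
        using far by simp
      have \<rho>: "0 < \<rho>"
      proof -
        have "0 < \<Omega> * \<rho>"
          using gap pi_gt_zero by (smt (verit) mult_nonneg_nonneg of_nat_0_le_iff)
        then show ?thesis
          using pos by (simp add: zero_less_mult_iff)
      qed
      let ?ball = "\<lambda>A. {u \<in> A. \<bar>u - t\<bar> < \<rho> / 2}"
      have "\<bar>u - t\<bar> < \<rho> / 2" if "u \<in> ?U" for u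
      proof -
        have "\<Omega> * \<bar>u - t\<bar> \<le> 2 * pi * s"
          using that by (simp add: abs_minus_commute)
        then have "\<Omega> * \<bar>u - t\<bar> < \<Omega> * (\<rho> / 2)"
          using gap by simp
        then show ?thesis
          using pos by simp
      qed
      then have "insert t ?U \<subseteq> ?ball A \<union> ?ball B"
        using t \<rho> by (auto simp: T_def)
      then have "card (insert t ?U) \<le> card (?ball A \<union> ?ball B)"
        using A B by (intro card_mono) auto
      also have "\<dots> \<le> card (?ball A) + card (?ball B)"
        by (rule card_Un_le)
      also have "\<dots> \<le> l + l"
        using A B by (intro add_mono card_ball_le) auto
      finally show ?thesis
        using T by simp
    qed
    moreover have "\<Delta> \<le> \<bar>t - u\<bar>" if "u \<in> T" "u \<noteq> t" for u
      using that t A B pos by (intro grid_separated) (auto simp: T_def)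
    moreover have "2 * \<Omega> * \<Delta> \<le> pi * real (2 * s)"
    proof -
      have "\<Omega> * \<Delta> \<le> pi * 1"
        using srf pos by (simp add: SRF_def field_simps)
      also have "\<dots> \<le> pi * s"
        using pos by (intro mult_left_mono) auto
      finally show ?thesis
        by simp
    qed
    ultimately have "\<Omega> * (cmod (?a t) * q ^ (2 * l - 1))\<^sup>2 \<le> 4 ^ (2 * s) * ?J"
      using amplitude_bound[OF T(1,2) t pos(2,1), of "2 * l - 1" ?a]
      unfolding q fourier_superset[OF T(1,3)] by blast
    also have "\<dots> \<le> 4 ^ (2 * s) * (8 * \<Omega> * \<epsilon>\<^sup>2)"
      using J by (intro mult_left_mono) auto
    finally have "\<Omega> * (cmod (?a t) * q ^ (2 * l - 1))\<^sup>2 \<le> \<Omega> * (8 * 4 ^ (2 * s) * \<epsilon>\<^sup>2)"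
      by (simp add: mult_ac)
    then show ?thesis
      using pos(2) by simp
  qed
  have q0: "0 < q"
    using pos srf by (auto simp: q_def)
  have "(measure_norm2 (\<nu> - \<mu>) * q ^ (2 * l - 1))\<^sup>2 = (\<Sum>t\<in>T. (cmod (?a t) * q ^ (2 * l - 1))\<^sup>2)"
    unfolding measure_norm2_superset[OF T(1,3)] L2_set_def
    by (simp add: power_mult_distrib sum_nonneg flip: sum_distrib_right)
  also have "\<dots> \<le> (\<Sum>t\<in>T. 8 * 4 ^ (2 * s) * \<epsilon>\<^sup>2)"
    by (intro sum_mono amplitude)
  also have "\<dots> = card T * (8 * 4 ^ (2 * s) * \<epsilon>\<^sup>2)"
    by simp
  also have "\<dots> \<le> 2 * real s ^ 2 * (8 * 4 ^ (2 * s) * \<epsilon>\<^sup>2)"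
  proof (rule mult_right_mono)
    \<comment> \<open>The wasteful square turns the right-hand side into the square of a rational expression.\<close>
    have "card T \<le> 2 * (s * s)"
      using T(2) le_square[of s] by linarith
    then have "real (card T) \<le> real (2 * (s * s))"
      by (rule of_nat_mono)
    then show "real (card T) \<le> 2 * real s ^ 2"
      by (simp add: power2_eq_square)
  qed simp
  also have "\<dots> = (4 ^ (s + 1) * s * \<epsilon>)\<^sup>2"
    unfolding power_even_eq[of 4 s] power_mult_distrib power_add by (simp add: power2_eq_square)
  finally have "measure_norm2 (\<nu> - \<mu>) * q ^ (2 * l - 1) \<le> 4 ^ (s + 1) * s * \<epsilon>"
    by (rule power2_le_imp_le) (use pos in simp)
  then have "measure_norm2 (\<nu> - \<mu>) \<le> 4 ^ (s + 1) * s * \<epsilon> / q ^ (2 * l - 1)"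
    using q0 by (simp add: pos_le_divide_eq)
  also have "\<dots> = 4 ^ (s + 1) * (real s * real s ^ (2 * l - 1)) * SRF \<Delta> \<Omega> ^ (2 * l - 1) * \<epsilon>"
    by (simp add: q_def power_divide power_mult_distrib)
  also have "real s * real s ^ (2 * l - 1) = real s ^ (2 * l)"
    using pos(5) by (simp flip: power_Suc)
  finally show ?thesis by simp
qed

section \<open>Two interlacing clusters that are hard to tell apart\<close>

definition alternate_cluster :: "real \<Rightarrow> nat \<Rightarrow> nat \<Rightarrow> real set" where
  "alternate_cluster \<Delta> l p = (\<lambda>i. real (2 * i + p) * \<Delta>) ` {..<l}"

text \<open>For \<open>p = 0\<close> and \<open>p = 1\<close>, the terms of even and of odd index of \<open>c (1 - z) ^ (2 l - 1)\<close>, all with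
  positive sign, read as masses on the multiples of \<open>\<Delta>\<close>.\<close>

definition alternate_measure :: "real \<Rightarrow> real \<Rightarrow> nat \<Rightarrow> nat \<Rightarrow> point_measure" where
  "alternate_measure c \<Delta> l p =
    (\<Sum>i<l. Poly_Mapping.single (real (2 * i + p) * \<Delta>)
      (complex_of_real c * of_nat ((2 * l - 1) choose (2 * i + p))))"

lemma keys_alternate_measure: "Poly_Mapping.keys (alternate_measure c \<Delta> l p) \<subseteq> alternate_cluster \<Delta> l p"
proof -
  have "Poly_Mapping.keys (alternate_measure c \<Delta> l p) \<subseteq> (\<Union>i\<in>{..<l}. {real (2 * i + p) * \<Delta>})"
    unfolding alternate_measure_def by (rule order_trans[OF keys_sum]) (auto split: if_splits)
  then show ?thesis
    by (auto simp: alternate_cluster_def)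
qed

lemma fourier_alternate_diff:
  assumes "1 \<le> l"
  shows "fourier (alternate_measure c \<Delta> l 0 - alternate_measure c \<Delta> l 1) \<omega> =
    c * (1 - exp (\<i> * complex_of_real (\<omega> * \<Delta>))) ^ (2 * l - 1)"
proof -
  define z where "z = exp (\<i> * complex_of_real (\<omega> * \<Delta>))"
  define n where "n = 2 * l - 1"
  have z: "exp (\<i> * complex_of_real (\<omega> * (real k * \<Delta>))) = z ^ k" for k
    by (simp add: z_def mult_ac flip: exp_of_nat_mult)
  define g where "g k = complex_of_real c * (of_nat (n choose k) * (- z) ^ k)" for k
  have pair: "(\<Sum>i<l. g (2 * i) + g (2 * i + 1)) = (\<Sum>k<2 * l. g k)"
    by (induction l) auto
  have "fourier (alternate_measure c \<Delta> l 0 - alternate_measure c \<Delta> l 1) \<omega> =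
    (\<Sum>i<l. g (2 * i) + g (2 * i + 1))"
    unfolding fourier_diff alternate_measure_def fourier_sum fourier_single z
      sum_subtractf[symmetric] n_def[symmetric]
    by (rule sum.cong) (simp_all add: g_def mult_ac)
  also have "\<dots> = (\<Sum>k\<le>n. g k)"
    unfolding pair using assms by (intro sum.cong) (auto simp: n_def)
  also have "\<dots> = c * (1 - z) ^ n"
    unfolding g_def sum_distrib_left[symmetric]
    using binomial_ring[of "- z" 1 n] by simp
  finally show ?thesis
    by (simp add: z_def n_def)
qed

lemma norm_alternate_diff_ge:
  assumes "1 \<le> l" "0 < \<Delta>" "0 \<le> c"
  shows "c \<le> measure_norm2 (alternate_measure c \<Delta> l 0 - alternate_measure c \<Delta> l 1)"
proof -
  have "Poly_Mapping.lookup (alternate_measure c \<Delta> l 1) 0 = 0"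
    using assms by (simp add: alternate_measure_def lookup_sum lookup_single when_def)
  moreover have "Poly_Mapping.lookup (alternate_measure c \<Delta> l 0) 0 =
    (\<Sum>i<l. if i = 0 then complex_of_real c else 0)"
    unfolding alternate_measure_def lookup_sum
    by (rule sum.cong) (use assms in \<open>auto simp: lookup_single when_def\<close>)
  ultimately have "Poly_Mapping.lookup (alternate_measure c \<Delta> l 0 - alternate_measure c \<Delta> l 1) 0 = c"
    using assms by (simp add: lookup_minus)
  then show ?thesis
    using norm_lookup_le_measure_norm2[of
        "alternate_measure c \<Delta> l 0 - alternate_measure c \<Delta> l 1" 0] assms by simp
qed

text \<open>For a coarse grid the spacing already exceeds \<open>pi / (4 s)\<close> and any unused grid points will do.
  Otherwise the nodes are put on the negative side of the cluster, at multiples of a grid length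
  between \<open>pi / (4 s)\<close> and \<open>pi / (2 s)\<close>; at most \<open>s\<close> such steps stay above \<open>- pi / 2\<close>.\<close>

lemma isolated_grid_nodes:
  assumes "0 < \<Delta>" "1 \<le> s" "n \<le> s" "finite K" "K \<subseteq> grid \<Delta> \<inter> {-(pi/2)<..pi/2}"
    and "\<And>x. x \<in> K \<Longrightarrow> 0 \<le> x" "n + card K \<le> card (grid \<Delta> \<inter> {-(pi/2)<..pi/2})"
  obtains E where "E \<subseteq> grid \<Delta> \<inter> {-(pi/2)<..pi/2}" "card E = n" "finite E" "E \<inter> K = {}"
    "\<And>e y. e \<in> E \<Longrightarrow> y \<in> K \<union> E \<Longrightarrow> y \<noteq> e \<Longrightarrow> pi / (4 * s) \<le> \<bar>y - e\<bar>"
proof (cases "pi / (4 * s) \<le> \<Delta>")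
  case True
  have "n \<le> card (grid \<Delta> \<inter> {-(pi/2)<..pi/2} - K)"
    using assms by (subst card_Diff_subset) auto
  then obtain E where E: "E \<subseteq> grid \<Delta> \<inter> {-(pi/2)<..pi/2} - K" "card E = n" "finite E"
    by (rule obtain_subset_with_card_n)
  have "pi / (4 * s) \<le> \<bar>y - e\<bar>" if "e \<in> E" "y \<in> K \<union> E" "y \<noteq> e" for e y
    using grid_separated[of y \<Delta> e] that E assms True by fastforce
  with E show ?thesis
    by (intro that) auto
next
  case False
  define \<rho> where "\<rho> = pi / (4 * s)"
  define m where "m = \<lceil>\<rho> / \<Delta>\<rceil>"
  have \<rho>: "0 < \<rho>" "\<Delta> < \<rho>"
    using False assms by (auto simp: \<rho>_def)
  have "\<rho> / \<Delta> \<le> of_int m" "of_int m < \<rho> / \<Delta> + 1"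
    unfolding m_def by linarith+
  then have m: "\<rho> \<le> m * \<Delta>" "m * \<Delta> < 2 * \<rho>"
    using assms(1) \<rho> by (auto simp: field_simps)
  define node where "node j = - (real j * (m * \<Delta>))" for j
  have gap: "\<rho> \<le> \<bar>node i - node j\<bar>" if "i \<noteq> j" for i j
  proof -
    have "1 \<le> \<bar>real i - real j\<bar>"
      using that by linarith
    then have "1 * (m * \<Delta>) \<le> \<bar>real i - real j\<bar> * (m * \<Delta>)"
      using m \<rho> by (intro mult_right_mono) auto
    moreover have "\<bar>node i - node j\<bar> = \<bar>real i - real j\<bar> * (m * \<Delta>)"
    proof -
      have "node i - node j = - ((real i - real j) * (m * \<Delta>))"
        by (simp add: node_def algebra_simps)
      moreover have "\<bar>m * \<Delta>\<bar> = m * \<Delta>"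
        using m \<rho> by (intro abs_of_pos) linarith
      ultimately show ?thesis
        by (simp only: abs_minus_cancel abs_mult[of "real i - real j" "m * \<Delta>"])
    qed
    ultimately show ?thesis
      using m by linarith
  qed
  have node: "node j \<in> grid \<Delta> \<inter> {-(pi/2)<..pi/2}" "node j \<le> - \<rho>" if "j \<in> {1..n}" for j
  proof -
    have "real j * (m * \<Delta>) \<le> real s * (m * \<Delta>)"
      using that assms m \<rho> by (intro mult_right_mono) auto
    also have "\<dots> < s * (2 * \<rho>)"
      using m assms by (intro mult_strict_left_mono) auto
    also have "\<dots> = pi / 2"
      using assms by (simp add: \<rho>_def)
    finally have "real j * (m * \<Delta>) < pi / 2" .
    moreover have "1 * (m * \<Delta>) \<le> real j * (m * \<Delta>)"
      using that m \<rho> by (intro mult_right_mono) auto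
    moreover have "node j = of_int (- (int j * m)) * \<Delta>"
      by (simp add: node_def)
    ultimately show "node j \<in> grid \<Delta> \<inter> {-(pi/2)<..pi/2}" "node j \<le> - \<rho>"
      using grid_memberI[OF assms(1), of "- (int j * m)"] m \<rho> by (auto simp: node_def mult.assoc)
  qed
  show ?thesis
  proof (rule that)
    have "inj_on node {1..n}"
    proof (rule inj_onI, rule ccontr)
      fix i j
      assume "node i = node j" "i \<noteq> j"
      then show False
        using gap[of i j] \<rho> by simp
    qed
    then show "card (node ` {1..n}) = n"
      by (simp add: card_image)
    show "node ` {1..n} \<inter> K = {}"
      using node(2) assms(6) \<rho> by fastforce
    show "pi / (4 * s) \<le> \<bar>y - e\<bar>" if e: "e \<in> node ` {1..n}" "y \<in> K \<union> node ` {1..n}" "y \<noteq> e" for e y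
    proof -
      obtain j where j: "j \<in> {1..n}" "e = node j"
        using e by auto
      have "\<rho> \<le> \<bar>y - e\<bar>"
      proof (cases "y \<in> K")
        case True
        then show ?thesis
          using node(2)[OF j(1)] assms(6)[of y] j by simp
      next
        case False
        then obtain i where "y = node i"
          using e by auto
        then show ?thesis
          using gap[of i j] e j by auto
      qed
      then show ?thesis
        by (simp add: \<rho>_def)
    qed
  qed (use node in auto)
qed

text \<open>The \<open>l\<close> nodes with spacing \<open>2 \<Delta>\<close> form a single cluster of diameter \<open>(2 l - 2) \<Delta>\<close>, which dictates
  \<open>\<tau>\<close>; the remaining \<open>s - l\<close> nodes are isolated and form clusters of their own.\<close>

lemma alternate_cluster_measures:
  assumes \<Delta>: "0 < \<Delta>" "(2 * real l - 1) * \<Delta> < pi / 2"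
    and l: "1 \<le> l" "l \<le> s" and s: "s \<le> card (grid \<Delta> \<inter> {-(pi/2)<..pi/2})"
    and p: "p \<le> 1" and keys: "Poly_Mapping.keys \<mu> \<subseteq> alternate_cluster \<Delta> l p"
  shows "\<mu> \<in> cluster_measures \<Delta> (pi / (4 * s)) s l (2 * real l - 2)"
proof -
  let ?K = "alternate_cluster \<Delta> l p"
  have inj: "inj_on (\<lambda>i. real (2 * i + p) * \<Delta>) {..<l}"
    using \<Delta> by (auto simp: inj_on_def)
  have K: "finite ?K" "card ?K = l" "\<And>x. x \<in> ?K \<Longrightarrow> 0 \<le> x"
    using card_image[OF inj] \<Delta> by (auto simp: alternate_cluster_def)
  have Kgrid: "?K \<subseteq> grid \<Delta> \<inter> {-(pi/2)<..pi/2}"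
  proof
    fix x
    assume "x \<in> ?K"
    then obtain i where i: "i < l" "x = real (2 * i + p) * \<Delta>"
      by (auto simp: alternate_cluster_def)
    then have "2 * i + p \<le> 2 * l - 1"
      using p by linarith
    then have "real (2 * i + p) \<le> 2 * real l - 1"
      using l by linarith
    then have "real (2 * i + p) * \<Delta> \<le> (2 * real l - 1) * \<Delta>"
      using \<Delta> by (intro mult_right_mono) auto
    also have "\<dots> < pi / 2"
      by (rule \<Delta>)
    finally have "\<bar>real (2 * i + p) * \<Delta>\<bar> < pi / 2"
      using \<Delta> by (simp only: abs_of_nonneg mult_nonneg_nonneg of_nat_0_le_iff less_imp_le)
    then show "x \<in> grid \<Delta> \<inter> {-(pi/2)<..pi/2}"
      using grid_memberI[OF \<Delta>(1), of "int (2 * i + p)"] by (simp only: i of_int_of_nat_eq)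
  qed
  have diam: "\<bar>y - x\<bar> \<le> (2 * real l - 2) * \<Delta>" if "x \<in> ?K" "y \<in> ?K" for x y
  proof -
    from that(1) obtain i where i: "i < l" "x = real (2 * i + p) * \<Delta>"
      by (auto simp: alternate_cluster_def)
    from that(2) obtain j where j: "j < l" "y = real (2 * j + p) * \<Delta>"
      by (auto simp: alternate_cluster_def)
    have "y - x = (2 * real j - 2 * real i) * \<Delta>"
      by (simp add: i j algebra_simps)
    then have "\<bar>y - x\<bar> = \<bar>2 * real j - 2 * real i\<bar> * \<Delta>"
      using \<Delta> by (simp add: abs_mult)
    also have "\<dots> \<le> (2 * real l - 2) * \<Delta>"
      using \<Delta> i j by (intro mult_right_mono) linarith+
    finally show ?thesis .
  qed
  obtain E where E: "E \<subseteq> grid \<Delta> \<inter> {-(pi/2)<..pi/2}" "card E = s - l" "finite E" "E \<inter> ?K = {}"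
    "\<And>e y. e \<in> E \<Longrightarrow> y \<in> ?K \<union> E \<Longrightarrow> y \<noteq> e \<Longrightarrow> pi / (4 * s) \<le> \<bar>y - e\<bar>"
    using isolated_grid_nodes[of \<Delta> s "s - l" ?K] K Kgrid \<Delta> l s by auto
  have "\<forall>x\<in>?K \<union> E. \<exists>Y. Y \<subseteq> ?K \<union> E \<and> x \<in> Y \<and> card Y \<le> l \<and>
      (\<forall>y\<in>Y - {x}. \<Delta> \<le> \<bar>y - x\<bar> \<and> \<bar>y - x\<bar> \<le> (2 * real l - 2) * \<Delta>) \<and>
      (\<forall>y\<in>?K \<union> E - Y. pi / (4 * s) \<le> \<bar>y - x\<bar>)" (is "Ball _ ?clustered")
  proof
    fix x
    assume x: "x \<in> ?K \<union> E"
    show "?clustered x"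
    proof (cases "x \<in> ?K")
      case True
      have "\<Delta> \<le> \<bar>y - x\<bar>" if "y \<in> ?K - {x}" for y
        using that True Kgrid \<Delta> by (intro grid_separated) auto
      moreover have "pi / (4 * s) \<le> \<bar>y - x\<bar>" if "y \<in> E" for y
        using E(5)[of y x] E(4) that True by (auto simp: abs_minus_commute)
      ultimately show ?thesis
        using True K diam by (intro exI[of _ ?K]) auto
    next
      case False
      then show ?thesis
        using x E(5)[of x] l by (intro exI[of _ "{x}"]) auto
    qed
  qed
  moreover have "card (?K \<union> E) = s"
    using K E l by (subst card_Un_disjoint) auto
  ultimately show ?thesis
    unfolding cluster_measures_iff using K(1) Kgrid E(1,3) keys
    by (intro exI[of _ "?K \<union> E"] conjI finite_UnI Un_least le_supI1)
qed

text \<open>If the grid has fewer than \<open>s\<close> points in the interval then the class is empty and the error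
  infinite. Otherwise the two alternating measures, scaled such that their transforms differ by at
  most \<open>\<epsilon>\<close>, are at distance at least the scaling factor \<open>c\<close>.\<close>

lemma minimax_error_cluster_measures_ge:
  assumes "0 < \<Delta>" "(2 * real l - 1) * \<Delta> < pi / 2" "1 \<le> l" "l \<le> s" "0 < \<epsilon>" "0 < \<Omega>"
  shows "ennreal (1 / (2 * pi ^ (2 * l - 1)) * SRF \<Delta> \<Omega> ^ (2 * l - 1) * \<epsilon>) \<le>
    minimax_error (cluster_measures \<Delta> (pi / (4 * s)) s l (2 * real l - 2)) \<Omega> \<epsilon>"
proof (cases "cluster_measures \<Delta> (pi / (4 * s)) s l (2 * real l - 2) = {}")
  case False
  then obtain S where S: "finite S" "card S = s" "S \<subseteq> grid \<Delta> \<inter> {-(pi/2)<..pi/2}"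
    using cluster_measures_iff by (metis equals0I)
  then have s: "s \<le> card (grid \<Delta> \<inter> {-(pi/2)<..pi/2})"
    using finite_grid by (metis card_mono finite_Int)
  define n where "n = 2 * l - 1"
  define c where "c = (SRF \<Delta> \<Omega> / pi) ^ n * \<epsilon>"
  have srf: "SRF \<Delta> \<Omega> / pi = 1 / (\<Delta> * \<Omega>)"
    by (simp add: SRF_def)
  have c: "0 \<le> c"
    using assms by (simp add: c_def srf)
  let ?\<mu> = "alternate_measure c \<Delta> l 0"
  let ?\<nu> = "alternate_measure c \<Delta> l 1"
  have pointwise: "(cmod (fourier (?\<mu> - ?\<nu>) \<omega>))\<^sup>2 \<le> \<epsilon>\<^sup>2" if "\<omega> \<in> {-\<Omega>..\<Omega>}" for \<omega>
  proof (rule power_mono)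
    have "cmod (1 - exp (\<i> * complex_of_real (\<omega> * \<Delta>))) \<le> \<bar>\<omega> * \<Delta>\<bar>"
      by (rule norm_exp_diff_le)
    also have "\<dots> \<le> \<Delta> * \<Omega>"
      using that assms by (auto simp: abs_mult mult.commute intro!: mult_left_mono)
    finally have "cmod (1 - exp (\<i> * complex_of_real (\<omega> * \<Delta>))) ^ n \<le> (\<Delta> * \<Omega>) ^ n"
      by (rule power_mono) simp
    then have "c * cmod (1 - exp (\<i> * complex_of_real (\<omega> * \<Delta>))) ^ n \<le> c * (\<Delta> * \<Omega>) ^ n"
      using c by (rule mult_left_mono)
    also have "\<dots> = \<epsilon>"
      using assms by (simp add: c_def srf power_divide)
    finally show "cmod (fourier (?\<mu> - ?\<nu>) \<omega>) \<le> \<epsilon>"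
      unfolding fourier_alternate_diff[OF assms(3)] norm_mult norm_power n_def[symmetric]
      using c by simp
  qed simp
  have "integral {-\<Omega>..\<Omega>} (\<lambda>\<omega>. (cmod (fourier (?\<mu> - ?\<nu>) \<omega>))\<^sup>2) \<le> integral {-\<Omega>..\<Omega>} (\<lambda>\<omega>. \<epsilon>\<^sup>2)"
    by (intro integral_le integrable_continuous_interval continuous_intros pointwise)
  then have "1 / (2 * \<Omega>) * integral {-\<Omega>..\<Omega>} (\<lambda>\<omega>. (cmod (fourier (?\<mu> - ?\<nu>) \<omega>))\<^sup>2) \<le> \<epsilon>\<^sup>2"
    using assms by (simp add: field_simps)
  then have "L2_band_norm \<Omega> (fourier (?\<mu> - ?\<nu>)) \<le> \<epsilon>"
    using assms by (simp add: L2_band_norm_continuous continuous_on_fourier real_le_lsqrt)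
  then have hard: "ennreal (measure_norm2 (?\<mu> - ?\<nu>) / 2) \<le>
      minimax_error (cluster_measures \<Delta> (pi / (4 * s)) s l (2 * real l - 2)) \<Omega> \<epsilon>"
    by (intro minimax_error_ge alternate_cluster_measures[OF assms(1-4) s _ keys_alternate_measure])
       (use assms in auto)
  moreover have rate: "1 / (2 * pi ^ (2 * l - 1)) * SRF \<Delta> \<Omega> ^ (2 * l - 1) * \<epsilon> = c / 2"
    by (simp add: c_def n_def power_divide)
  moreover have "ennreal (c / 2) \<le> ennreal (measure_norm2 (?\<mu> - ?\<nu>) / 2)"
    using norm_alternate_diff_ge[OF assms(3,1) c] by (intro ennreal_leI) simp
  ultimately show ?thesis
    unfolding rate by (intro order_trans[OF _ hard])
qed (simp add: minimax_error_empty)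

section \<open>Two-sided bounds for the minimax error\<close>

theorem theorem3p14:
  shows
    "(\<forall>s l :: nat. 1 \<le> s \<longrightarrow> 2 \<le> l \<longrightarrow> l \<le> s \<longrightarrow>
       (\<exists>C :: real. 0 < C \<and>
         (\<forall>\<epsilon> \<rho> \<tau> M :: real. 0 < \<epsilon> \<longrightarrow> 0 \<le> \<rho> \<longrightarrow> (0 < \<rho> \<or> l = s) \<longrightarrow> real l - 1 \<le> \<tau> \<longrightarrow> pi \<le> M \<longrightarrow>
           (\<exists>\<alpha>\<ge>M. \<forall>\<^sub>F \<Delta> in at_right 0. \<forall>\<Omega>>0. SRF \<Delta> \<Omega> = \<alpha> \<longrightarrow>
              cluster_measures \<Delta> \<rho> s l \<tau> \<noteq> {} \<longrightarrow>
              minimax_error (cluster_measures \<Delta> \<rho> s l \<tau>) \<Omega> \<epsilon>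
                \<le> ennreal (C * SRF \<Delta> \<Omega> ^ (2 * l - 1) * \<epsilon>)))))
     \<and>
     (\<exists>\<beta> :: real. 1 < \<beta> \<and>
       (\<exists>C :: nat \<Rightarrow> real. (\<forall>l. 0 < C l) \<and>
         (\<forall>s l :: nat. 1 \<le> s \<longrightarrow> 2 \<le> l \<longrightarrow> l \<le> s \<longrightarrow>
           (\<exists>\<rho>' \<tau>' :: real. 0 < \<rho>' \<and> real l - 1 \<le> \<tau>' \<and>
             (\<forall>\<Delta> :: real. 0 < \<Delta> \<longrightarrow> \<Delta> < pi / (2 * (2 * real l - 1)) \<longrightarrow>
                \<tau>' < pi / \<Delta> \<and>
                (s \<le> card (grid \<Delta> \<inter> {-(pi/2)<..pi/2}) \<longrightarrow>
                   cluster_measures \<Delta> \<rho>' s l \<tau>' \<noteq> {}) \<and>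
                (\<forall>\<epsilon> \<Omega> :: real. 0 < \<epsilon> \<longrightarrow> 0 < \<Omega> \<longrightarrow> \<beta> < SRF \<Delta> \<Omega> \<longrightarrow>
                   ennreal (C l * SRF \<Delta> \<Omega> ^ (2 * l - 1) * \<epsilon>)
                     \<le> minimax_error (cluster_measures \<Delta> \<rho>' s l \<tau>') \<Omega> \<epsilon>))))))"
proof (intro conjI allI impI)
  fix s l :: nat
  assume sl: "1 \<le> s" "2 \<le> l" "l \<le> s"
  define C :: real where "C = 4 ^ (s + 1) * real s ^ (2 * l)"
  have C: "0 < C"
    using sl by (simp add: C_def)
  have upper: "\<exists>\<alpha>\<ge>M. \<forall>\<^sub>F \<Delta> in at_right 0. \<forall>\<Omega>>0. SRF \<Delta> \<Omega> = \<alpha> \<longrightarrow>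
      cluster_measures \<Delta> \<rho> s l \<tau> \<noteq> {} \<longrightarrow>
      minimax_error (cluster_measures \<Delta> \<rho> s l \<tau>) \<Omega> \<epsilon> \<le> ennreal (C * SRF \<Delta> \<Omega> ^ (2 * l - 1) * \<epsilon>)"
    if par: "0 < \<epsilon>" "0 \<le> \<rho>" "0 < \<rho> \<or> l = s" "pi \<le> M" for \<epsilon> \<rho> \<tau> M :: real
  proof (intro exI[of _ M] conjI order_refl)
    have M: "1 \<le> M" "0 < M"
      using par(4) pi_ge_two by linarith+
    \<comment> \<open>As \<open>\<Omega> = pi / (M \<Delta>)\<close>, this is the threshold for \<open>4 pi s < \<Omega> \<rho>\<close>.\<close>
    define \<Delta>0 where "\<Delta>0 = (if 0 < \<rho> then \<rho> / (4 * s * M) else 1)"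
    have "0 < \<Delta>0"
      using sl M by (simp add: \<Delta>0_def)
    then have "\<forall>\<^sub>F \<Delta> in at_right 0. \<Delta> \<in> {0<..<\<Delta>0}"
      by (rule eventually_at_right_real)
    then show "\<forall>\<^sub>F \<Delta> in at_right 0. \<forall>\<Omega>>0. SRF \<Delta> \<Omega> = M \<longrightarrow>
      cluster_measures \<Delta> \<rho> s l \<tau> \<noteq> {} \<longrightarrow>
      minimax_error (cluster_measures \<Delta> \<rho> s l \<tau>) \<Omega> \<epsilon> \<le> ennreal (C * SRF \<Delta> \<Omega> ^ (2 * l - 1) * \<epsilon>)"
    proof eventually_elim
      case (elim \<Delta>)
      show ?case
      proof (intro allI impI)
        fix \<Omega> :: real
        assume \<Omega>: "0 < \<Omega>" "SRF \<Delta> \<Omega> = M" and R: "cluster_measures \<Delta> \<rho> s l \<tau> \<noteq> {}"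
        have far: "4 * pi * s < \<Omega> * \<rho> \<or> l = s"
        proof (cases "l = s")
          case False
          then have \<rho>: "0 < \<rho>"
            using par(3) by simp
          have "pi = M * (\<Delta> * \<Omega>)"
            using \<Omega> elim by (auto simp: SRF_def field_simps)
          then have "4 * pi * s = 4 * (M * (\<Delta> * \<Omega>)) * s"
            by (rule arg_cong)
          also have "\<dots> = \<Omega> * (\<Delta> * (4 * s * M))"
            by simp
          also have "\<dots> < \<Omega> * \<rho>"
            using elim \<rho> sl M \<Omega> by (intro mult_strict_left_mono) (auto simp: \<Delta>0_def field_simps)
          finally show ?thesis ..
        qed simp
        show "minimax_error (cluster_measures \<Delta> \<rho> s l \<tau>) \<Omega> \<epsilon> \<le>
          ennreal (C * SRF \<Delta> \<Omega> ^ (2 * l - 1) * \<epsilon>)"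
          unfolding C_def
          by (rule minimax_error_le[OF R \<Omega>(1)], rule cluster_measures_stable)
             (use \<Omega> elim par sl M far in auto)
      qed
    qed
  qed
  show "\<exists>C :: real. 0 < C \<and>
       (\<forall>\<epsilon> \<rho> \<tau> M :: real. 0 < \<epsilon> \<longrightarrow> 0 \<le> \<rho> \<longrightarrow> (0 < \<rho> \<or> l = s) \<longrightarrow> real l - 1 \<le> \<tau> \<longrightarrow> pi \<le> M \<longrightarrow>
         (\<exists>\<alpha>\<ge>M. \<forall>\<^sub>F \<Delta> in at_right 0. \<forall>\<Omega>>0. SRF \<Delta> \<Omega> = \<alpha> \<longrightarrow>
            cluster_measures \<Delta> \<rho> s l \<tau> \<noteq> {} \<longrightarrow>
            minimax_error (cluster_measures \<Delta> \<rho> s l \<tau>) \<Omega> \<epsilon>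
              \<le> ennreal (C * SRF \<Delta> \<Omega> ^ (2 * l - 1) * \<epsilon>)))"
    by (rule exI[of _ C], intro conjI allI impI C, rule upper)
next
  define C :: "nat \<Rightarrow> real" where "C l = 1 / (2 * pi ^ (2 * l - 1))" for l
  have lower: "\<exists>\<rho>' \<tau>' :: real. 0 < \<rho>' \<and> real l - 1 \<le> \<tau>' \<and>
             (\<forall>\<Delta> :: real. 0 < \<Delta> \<longrightarrow> \<Delta> < pi / (2 * (2 * real l - 1)) \<longrightarrow>
                \<tau>' < pi / \<Delta> \<and>
                (s \<le> card (grid \<Delta> \<inter> {-(pi/2)<..pi/2}) \<longrightarrow>
                   cluster_measures \<Delta> \<rho>' s l \<tau>' \<noteq> {}) \<and>
                (\<forall>\<epsilon> \<Omega> :: real. 0 < \<epsilon> \<longrightarrow> 0 < \<Omega> \<longrightarrow> 2 < SRF \<Delta> \<Omega> \<longrightarrow>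
                   ennreal (C l * SRF \<Delta> \<Omega> ^ (2 * l - 1) * \<epsilon>)
                     \<le> minimax_error (cluster_measures \<Delta> \<rho>' s l \<tau>') \<Omega> \<epsilon>))"
    if sl: "1 \<le> s" "2 \<le> l" "l \<le> s" for s l :: nat
  proof (rule exI[of _ "pi / (4 * s)"], rule exI[of _ "2 * real l - 2"], intro conjI allI impI)
    fix \<Delta> :: real
    assume \<Delta>: "0 < \<Delta>" "\<Delta> < pi / (2 * (2 * real l - 1))"
    have fits: "(2 * real l - 1) * \<Delta> < pi / 2"
      using \<Delta> sl by (simp add: field_simps)
    moreover have "(2 * real l - 2) * \<Delta> = (2 * real l - 1) * \<Delta> - \<Delta>"
      by (simp add: algebra_simps)
    ultimately have "(2 * real l - 2) * \<Delta> < pi"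
      using \<Delta>(1) pi_gt_zero by linarith
    then show "2 * real l - 2 < pi / \<Delta>"
      using \<Delta> by (simp add: pos_less_divide_eq)
    show "cluster_measures \<Delta> (pi / (4 * s)) s l (2 * real l - 2) \<noteq> {}"
      if "s \<le> card (grid \<Delta> \<inter> {-(pi/2)<..pi/2})"
    proof -
      have "0 \<in> cluster_measures \<Delta> (pi / (4 * s)) s l (2 * real l - 2)"
        by (rule alternate_cluster_measures[OF \<Delta>(1) fits _ sl(3) that, of 0]) (use sl in auto)
      then show ?thesis
        by (rule ex_in_conv[THEN iffD1, OF exI])
    qed
    show "ennreal (C l * SRF \<Delta> \<Omega> ^ (2 * l - 1) * \<epsilon>) \<le>
        minimax_error (cluster_measures \<Delta> (pi / (4 * s)) s l (2 * real l - 2)) \<Omega> \<epsilon>"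
      if "0 < \<epsilon>" "0 < \<Omega>" for \<epsilon> \<Omega>
      unfolding C_def
      by (rule minimax_error_cluster_measures_ge[OF \<Delta>(1) fits _ sl(3) that]) (use sl in simp)
  qed (use sl in auto)
  show "\<exists>\<beta> :: real. 1 < \<beta> \<and>
       (\<exists>C :: nat \<Rightarrow> real. (\<forall>l. 0 < C l) \<and>
         (\<forall>s l :: nat. 1 \<le> s \<longrightarrow> 2 \<le> l \<longrightarrow> l \<le> s \<longrightarrow>
           (\<exists>\<rho>' \<tau>' :: real. 0 < \<rho>' \<and> real l - 1 \<le> \<tau>' \<and>
             (\<forall>\<Delta> :: real. 0 < \<Delta> \<longrightarrow> \<Delta> < pi / (2 * (2 * real l - 1)) \<longrightarrow>
                \<tau>' < pi / \<Delta> \<and>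
                (s \<le> card (grid \<Delta> \<inter> {-(pi/2)<..pi/2}) \<longrightarrow>
                   cluster_measures \<Delta> \<rho>' s l \<tau>' \<noteq> {}) \<and>
                (\<forall>\<epsilon> \<Omega> :: real. 0 < \<epsilon> \<longrightarrow> 0 < \<Omega> \<longrightarrow> \<beta> < SRF \<Delta> \<Omega> \<longrightarrow>
                   ennreal (C l * SRF \<Delta> \<Omega> ^ (2 * l - 1) * \<epsilon>)
                     \<le> minimax_error (cluster_measures \<Delta> \<rho>' s l \<tau>') \<Omega> \<epsilon>)))))"
    by (rule exI[of _ 2], rule conjI, simp, rule exI[of _ C], intro conjI allI impI,
        simp add: C_def, rule lower)
qed

end
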